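(* For every $\beta\in(0,2)$ with $\beta\neq1$, $$H_0^{\beta/2}(\mathbb R_* )=\left\{u\in H^{\beta/2}(\mathbb R):\int_{\mathbb R}\frac{u^2(y)}{|y|^\beta}\,dy<+\infty\right\}.$$
   Context: $\mathbb R_*=\mathbb R\setminus\{0\}$. For $\beta\in(0,2)$ let $q_\beta(y):=c_\beta|y|^{-1-\beta}$ with $c_\beta:=\frac{2^\beta\Gamma((1+\beta)/2)}{\sqrt\pi|\Gamma(-\beta/2)|}$, and for Borel $u:\mathbb R\to\mathbb R$ let $\mathcal E[u]:=\frac12\int_{\mathbb R^2}[u(y')-u(y)]^2q_\beta(y'-y)\,dy\,dy'\in[0,+\infty]$. $H^{\beta/2}(\mathbb R):=\{u\in L^2(\mathbb R):\mathcal E[u]<\infty\}$ with norm $\|u\|_{H^{\beta/2}(\mathbb R)}:=(\|u\|_{L^2(\mathbb R)}^2+\mathcal E[u])^{1/2}$, and $H_0^{\beta/2}(\mathbb R_* )$ is the completion of $C_c^\infty(\mathbb R_* )$ under this norm, viewed as a subspace of $H^{\beta/2}(\mathbb R)$. *)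

theory Defs
  imports "HOL-Analysis.Analysis"
begin

definition q_const :: "real \<Rightarrow> real" where
  "q_const \<beta> = 2 powr \<beta> * Gamma ((1 + \<beta>) / 2) / (sqrt pi * \<bar>Gamma (- \<beta> / 2)\<bar>)"

text \<open>At \<open>y = 0\<close> the kernel takes the value 0 instead of infinity. This only affects the
  diagonal in the energy below, a null set on which the increment vanishes anyway.\<close>

definition q_kernel :: "real \<Rightarrow> real \<Rightarrow> real" where
  "q_kernel \<beta> y = q_const \<beta> * \<bar>y\<bar> powr (- 1 - \<beta>)"

definition energy :: "real \<Rightarrow> (real \<Rightarrow> real) \<Rightarrow> ennreal" where
  "energy \<beta> u =
    (1 / 2) * (\<integral>\<^sup>+ (y, y'). ennreal ((u y' - u y)\<^sup>2 * q_kernel \<beta> (y' - y)) \<partial>(lborel \<Otimes>\<^sub>M lborel))"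

definition L2_sq :: "(real \<Rightarrow> real) \<Rightarrow> ennreal" where
  "L2_sq u = (\<integral>\<^sup>+ y. ennreal ((u y)\<^sup>2) \<partial>lborel)"

text \<open>The fractional Sobolev space consists here of Borel functions rather than of
  a.e.-equivalence classes; membership in each of the sets below is invariant under
  a.e.-modification by Borel functions.\<close>

definition sobolev_H :: "real \<Rightarrow> (real \<Rightarrow> real) set" where
  "sobolev_H \<beta> = {u \<in> borel_measurable borel. L2_sq u < \<infinity> \<and> energy \<beta> u < \<infinity>}"

text \<open>Only meaningful on \<open>sobolev_H \<beta>\<close>, since \<open>enn2real\<close> maps infinity to 0.\<close>

definition sobolev_norm :: "real \<Rightarrow> (real \<Rightarrow> real) \<Rightarrow> real" where
  "sobolev_norm \<beta> u = sqrt (enn2real (L2_sq u + energy \<beta> u))"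

text \<open>Test functions on an open set \<open>U\<close> are extended by 0 to the whole line.\<close>

definition test_functions :: "real set \<Rightarrow> (real \<Rightarrow> real) set" where
  "test_functions U =
    {\<phi>. (\<forall>n. (deriv ^^ n) \<phi> differentiable_on UNIV) \<and>
        compact (closure {x. \<phi> x \<noteq> 0}) \<and> closure {x. \<phi> x \<noteq> 0} \<subseteq> U}"

text \<open>The completion of the test functions on the punctured line, realised inside
  \<open>sobolev_H \<beta>\<close> as the set of limits of norm-convergent sequences of test functions. The
  differences \<open>\<phi> n - u\<close> lie in \<open>sobolev_H \<beta>\<close>, where \<open>sobolev_norm \<beta>\<close> is meaningful.\<close>

definition sobolev_H0 :: "real \<Rightarrow> (real \<Rightarrow> real) set" where
  "sobolev_H0 \<beta> =
    {u \<in> sobolev_H \<beta>. \<exists>\<phi>. (\<forall>n::nat. \<phi> n \<in> test_functions (- {0})) \<and>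
        (\<lambda>n. sobolev_norm \<beta> (\<lambda>y. \<phi> n y - u y)) \<longlonglongrightarrow> 0}"

end

theory Submission imports Defs begin

text \<open>
  One inclusion is the fractional Hardy inequality \<open>\<integral> \<phi>\<^sup>2 / \<bar>y\<bar>\<^sup>\<beta> \<le> C * energy \<beta> \<phi>\<close> for test functions
  supported away from \<open>0\<close>. The dilation \<open>\<phi> \<mapsto> \<phi> (t * _)\<close> multiplies the weighted integral by
  \<open>t\<^sup>\<beta>\<^sup>-\<^sup>1\<close>, which for \<open>t \<ge> 2\<close> stays away from \<open>1\<close> because \<open>\<beta> \<noteq> 1\<close>; hence the integral is controlled
  by that of \<open>(\<phi> (t * y) - \<phi> y)\<^sup>2 / \<bar>y\<bar>\<^sup>\<beta>\<close>. Averaging over \<open>t \<in> [2, 4]\<close> and substituting \<open>y' = t * y\<close>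
  gives a part of the energy. Truncating the weight near \<open>0\<close> makes the bound pass to limits.

  Conversely, if the weighted integral of \<open>u\<^sup>2\<close> is finite, \<open>u\<close> is multiplied by cutoffs \<open>\<eta>\<close> in
  \<open>ln \<bar>y\<bar>\<close>. They satisfy \<open>\<bar>\<eta> y' - \<eta> y\<bar> \<le> min 1 (2 * \<bar>y' - y\<bar> / \<bar>y\<bar>)\<close> uniformly, so the energy density of the
  error is dominated by that of \<open>u\<close> plus a kernel whose integral in \<open>y'\<close> is a multiple of
  \<open>u\<^sup>2 / \<bar>y\<bar>\<^sup>\<beta>\<close>, and dominated convergence applies. The truncated function is then mollified.
\<close>

subsection \<open>Energy and increments\<close>

text \<open>The Hardy argument absorbs the weighted integral into itself, so it says nothing when
  that integral is infinite. This is a real restriction: for \<beta> > 1 a smooth bump equal to 1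
  near 0 has finite energy and infinite weighted integral. The inequality is therefore stated for
  functions with \<open>hardy_sq \<beta> u < top\<close>, which covers test functions vanishing near
  0; for their limits finiteness is the conclusion and has to come from a bound that is uniform in
  the truncation of the weight. The energy is used in two shapes. The double integral over
  \<open>y\<close> and \<open>y'\<close> suits pointwise estimates of multipliers and the
  substitution \<open>y' = t * y\<close>. The integral over increments \<open>h\<close> reduces
  subadditivity, Lipschitz bounds and mollification to L2 statements for each fixed
  \<open>h\<close>. Norms stay squared and in \<open>ennreal\<close>. The factor 2 in the squared
  triangle inequality is harmless for convergence; only the absorption step needs a factor close to
  1.\<close>

lemma q_const_pos:
  assumes "\<beta> \<in> {0<..<2}"
  shows "q_const \<beta> > 0"
proof -
  \<comment> \<open>\<open>Gamma\<close> has the value 0 at its poles, so nonvanishing means that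
    \<beta> / 2 is not a natural number; it lies strictly between 0 and 1.\<close>
  have "- \<beta> / 2 \<notin> \<int>\<^sub>\<le>\<^sub>0"
  proof
    assume "- \<beta> / 2 \<in> \<int>\<^sub>\<le>\<^sub>0"
    then obtain n where "- \<beta> / 2 = - real n"
      by (auto elim: nonpos_Ints_cases')
    then have "\<beta> = 2 * real n" by simp
    with assms have "0 < real n" "real n < 1" by auto
    then show False by auto
  qed
  then have "Gamma (- \<beta> / 2) \<noteq> 0"
    by (simp add: Gamma_eq_zero_iff)
  moreover have "Gamma ((1 + \<beta>) / 2) > 0"
    using assms by (intro Gamma_real_pos) auto
  ultimately show ?thesis
    by (simp add: q_const_def)
qed

lemma q_kernel_nonneg: "\<beta> \<in> {0<..<2} \<Longrightarrow> q_kernel \<beta> y \<ge> 0"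
  using q_const_pos[of \<beta>] by (simp add: q_kernel_def)

lemma q_kernel_measurable [measurable]: "q_kernel \<beta> \<in> borel_measurable borel"
  unfolding q_kernel_def[abs_def] by measurable

section \<open>Translation invariance and squared triangle inequalities in L2\<close>

lemma nn_integral_lborel_shift:
  fixes h :: real
  assumes [measurable]: "f \<in> borel_measurable borel"
  shows "(\<integral>\<^sup>+x. f (x + h) \<partial>lborel) = (\<integral>\<^sup>+x. f x \<partial>lborel)"
  using nn_integral_real_affine[of f 1 h] by (simp add: add.commute)

lemma L2_sq_shift:
  assumes [measurable]: "u \<in> borel_measurable borel"
  shows "L2_sq (\<lambda>y. u (y + h)) = L2_sq u"
  unfolding L2_sq_def by (rule nn_integral_lborel_shift) measurable

lemma ennreal_square_add_le:
  "ennreal ((a + b)\<^sup>2) \<le> 2 * ennreal (a\<^sup>2) + 2 * ennreal (b\<^sup>2)"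
proof -
  have "(a + b)\<^sup>2 \<le> 2 * a\<^sup>2 + 2 * b\<^sup>2"
    using sum_squares_bound[of a b] by (simp add: power2_sum)
  then have "ennreal ((a + b)\<^sup>2) \<le> ennreal (2 * a\<^sup>2 + 2 * b\<^sup>2)"
    by (rule ennreal_leI)
  then show ?thesis
    by (simp add: ennreal_plus ennreal_mult')
qed

lemma L2_sq_add_le:
  assumes [measurable]: "u \<in> borel_measurable borel" "v \<in> borel_measurable borel"
  shows "L2_sq (\<lambda>y. u y + v y) \<le> 2 * L2_sq u + 2 * L2_sq v"
proof -
  have "L2_sq (\<lambda>y. u y + v y) \<le> (\<integral>\<^sup>+y. 2 * ennreal ((u y)\<^sup>2) + 2 * ennreal ((v y)\<^sup>2) \<partial>lborel)"
    unfolding L2_sq_def by (intro nn_integral_mono ennreal_square_add_le)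
  also have "\<dots> = 2 * L2_sq u + 2 * L2_sq v"
    unfolding L2_sq_def by (simp add: nn_integral_add nn_integral_cmult)
  finally show ?thesis .
qed

lemma L2_sq_uminus: "L2_sq (\<lambda>y. - u y) = L2_sq u"
  by (simp add: L2_sq_def)

lemma L2_sq_diff_commute: "L2_sq (\<lambda>y. u y - v y) = L2_sq (\<lambda>y. v y - u y)"
  by (simp add: L2_sq_def power2_commute)

lemma L2_sq_diff_le:
  assumes [measurable]: "u \<in> borel_measurable borel" "v \<in> borel_measurable borel"
  shows "L2_sq (\<lambda>y. u y - v y) \<le> 2 * L2_sq u + 2 * L2_sq v"
  using L2_sq_add_le[of u "\<lambda>y. - v y"] by (simp add: L2_sq_uminus)

section \<open>The energy as an integral over increments\<close>

lemma energy_eq_iterated: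
  assumes [measurable]: "u \<in> borel_measurable borel"
  shows "energy \<beta> u = (1 / 2) * (\<integral>\<^sup>+y. \<integral>\<^sup>+y'. ennreal ((u y' - u y)\<^sup>2 * q_kernel \<beta> (y' - y)) \<partial>lborel \<partial>lborel)"
  unfolding energy_def by (subst lborel.nn_integral_fst[symmetric]) auto

lemma L2_sq_increment_measurable [measurable]:
  assumes [measurable]: "u \<in> borel_measurable borel"
  shows "(\<lambda>h. L2_sq (\<lambda>y. u (y + h) - u y)) \<in> borel_measurable borel"
  unfolding L2_sq_def by measurable

text \<open>Substitution \<open>y' = y + h\<close> for fixed \<open>y\<close>, then Tonelli. The
  kernel now depends on \<open>h\<close> alone and acts as a weight on squared L2 norms of
  increments.\<close>

lemma energy_eq_increments:
  assumes [measurable]: "u \<in> borel_measurable borel" and \<beta>: "\<beta> \<in> {0<..<2}"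
  shows "energy \<beta> u = (1 / 2) *
    (\<integral>\<^sup>+h. ennreal (q_kernel \<beta> h) * L2_sq (\<lambda>y. u (y + h) - u y) \<partial>lborel)"
proof -
  have "(\<integral>\<^sup>+y. \<integral>\<^sup>+y'. ennreal ((u y' - u y)\<^sup>2 * q_kernel \<beta> (y' - y)) \<partial>lborel \<partial>lborel)
      = (\<integral>\<^sup>+y. \<integral>\<^sup>+h. ennreal ((u (y + h) - u y)\<^sup>2 * q_kernel \<beta> h) \<partial>lborel \<partial>lborel)"
  proof (rule nn_integral_cong)
    fix y
    show "(\<integral>\<^sup>+y'. ennreal ((u y' - u y)\<^sup>2 * q_kernel \<beta> (y' - y)) \<partial>lborel)
        = (\<integral>\<^sup>+h. ennreal ((u (y + h) - u y)\<^sup>2 * q_kernel \<beta> h) \<partial>lborel)"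
      using nn_integral_lborel_shift[of "\<lambda>y'. ennreal ((u y' - u y)\<^sup>2 * q_kernel \<beta> (y' - y))" y]
      by (simp add: add.commute)
  qed
  also have "\<dots> = (\<integral>\<^sup>+h. \<integral>\<^sup>+y. ennreal ((u (y + h) - u y)\<^sup>2 * q_kernel \<beta> h) \<partial>lborel \<partial>lborel)"
    by (rule lborel_pair.Fubini'[symmetric]) measurable
  also have "\<dots> = (\<integral>\<^sup>+h. ennreal (q_kernel \<beta> h) * L2_sq (\<lambda>y. u (y + h) - u y) \<partial>lborel)"
    unfolding L2_sq_def
    by (intro nn_integral_cong) (simp add: nn_integral_cmult[symmetric] ennreal_mult' mult.commute q_kernel_nonneg[OF \<beta>])
  finally show ?thesis
    by (simp add: energy_eq_iterated)
qed

lemma energy_add_le: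
  assumes [measurable]: "u \<in> borel_measurable borel" "v \<in> borel_measurable borel"
    and \<beta>: "\<beta> \<in> {0<..<2}"
  shows "energy \<beta> (\<lambda>y. u y + v y) \<le> 2 * energy \<beta> u + 2 * energy \<beta> v"
proof -
  let ?q = "\<lambda>h. ennreal (q_kernel \<beta> h)"
  have "(\<integral>\<^sup>+h. ?q h * L2_sq (\<lambda>y. u (y + h) + v (y + h) - (u y + v y)) \<partial>lborel)
     \<le> (\<integral>\<^sup>+h. 2 * (?q h * L2_sq (\<lambda>y. u (y + h) - u y)) + 2 * (?q h * L2_sq (\<lambda>y. v (y + h) - v y)) \<partial>lborel)"
  proof (rule nn_integral_mono)
    fix h
    have "L2_sq (\<lambda>y. u (y + h) + v (y + h) - (u y + v y))
      \<le> 2 * L2_sq (\<lambda>y. u (y + h) - u y) + 2 * L2_sq (\<lambda>y. v (y + h) - v y)"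
      using L2_sq_add_le[of "\<lambda>y. u (y + h) - u y" "\<lambda>y. v (y + h) - v y"]
      by (simp add: algebra_simps)
    from mult_left_mono[OF this, of "?q h"]
    show "?q h * L2_sq (\<lambda>y. u (y + h) + v (y + h) - (u y + v y))
      \<le> 2 * (?q h * L2_sq (\<lambda>y. u (y + h) - u y)) + 2 * (?q h * L2_sq (\<lambda>y. v (y + h) - v y))"
      by (simp add: algebra_simps)
  qed
  also have "\<dots> = 2 * (\<integral>\<^sup>+h. ?q h * L2_sq (\<lambda>y. u (y + h) - u y) \<partial>lborel)
      + 2 * (\<integral>\<^sup>+h. ?q h * L2_sq (\<lambda>y. v (y + h) - v y) \<partial>lborel)"
    by (simp add: nn_integral_add nn_integral_cmult)
  finally have "(1 / 2) * (\<integral>\<^sup>+h. ?q h * L2_sq (\<lambda>y. u (y + h) + v (y + h) - (u y + v y)) \<partial>lborel)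
      \<le> (1 / 2) * (2 * (\<integral>\<^sup>+h. ?q h * L2_sq (\<lambda>y. u (y + h) - u y) \<partial>lborel)
      + 2 * (\<integral>\<^sup>+h. ?q h * L2_sq (\<lambda>y. v (y + h) - v y) \<partial>lborel))"
    by (rule mult_left_mono) simp
  then show ?thesis
    unfolding energy_eq_increments[OF assms(1) \<beta>] energy_eq_increments[OF assms(2) \<beta>]
      energy_eq_increments[OF borel_measurable_add[OF assms(1,2)] \<beta>]
    by (simp only: distrib_left mult.left_commute)
qed

lemma energy_uminus: "energy \<beta> (\<lambda>y. - u y) = energy \<beta> u"
proof -
  have "(- u y' - - u y)\<^sup>2 = (u y' - u y)\<^sup>2" for y y'
    by (simp add: power2_eq_square algebra_simps)
  then show ?thesis by (simp add: energy_def)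
qed

lemma energy_diff_le:
  assumes [measurable]: "u \<in> borel_measurable borel" "v \<in> borel_measurable borel"
    and \<beta>: "\<beta> \<in> {0<..<2}"
  shows "energy \<beta> (\<lambda>y. u y - v y) \<le> 2 * energy \<beta> u + 2 * energy \<beta> v"
  using energy_add_le[of u "\<lambda>y. - v y", OF _ _ \<beta>] by (simp add: energy_uminus)

lemma ennreal_half_less_top_iff: "(1 / 2) * x < (top::ennreal) \<longleftrightarrow> x < top"
proof -
  have "(1 / 2 :: ennreal) = ennreal (1 / 2)"
    using divide_ennreal[of 1 2] by simp
  then have "(1 / 2 :: ennreal) < top"
    by (metis ennreal_less_top)
  then show ?thesis
    by (auto simp: ennreal_mult_less_top)
qed

text \<open>Both ends of the range of \<beta> enter: near 0 the integrand is |k|^(1 - \<beta>),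
  integrable as \<beta> < 2, and at infinity it is |k|^(-1 - \<beta>), integrable as \<beta> > 0.
  The integral serves twice, for the finite energy of Lipschitz functions with bounded support and
  for the constant in the cutoff estimate.\<close>

lemma nn_integral_min_powr_finite:
  assumes \<beta>: "\<beta> \<in> {0<..<2}" 
  shows "(\<integral>\<^sup>+k. ennreal (min 1 (k\<^sup>2) * \<bar>k\<bar> powr (- 1 - \<beta>)) \<partial>lborel) < top"
proof -
  let ?f = "\<lambda>k::real. ennreal (min 1 (k\<^sup>2) * \<bar>k\<bar> powr (- 1 - \<beta>))"
  let ?g = "\<lambda>k::real. ennreal (indicator {0..1} k * k powr (1 - \<beta>)) + ennreal (indicator {1..} k * k powr (- 1 - \<beta>))"
  have 1: "(\<integral>\<^sup>+k. ennreal (indicator {0..1} k * k powr (1 - \<beta>)) \<partial>lborel) = ennreal (1 / (2 - \<beta>))"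
  proof (rule nn_integral_has_integral_lborel)
    have "((\<lambda>k. k powr (1 - \<beta>)) has_integral (1 powr (1 - \<beta> + 1) / (1 - \<beta> + 1))) {0..1}"
      using \<beta> by (intro has_integral_powr_from_0) auto
    then have "((\<lambda>k. if k \<in> {0..1} then k powr (1 - \<beta>) else 0) has_integral (1 / (2 - \<beta>))) UNIV"
      by (subst has_integral_restrict_UNIV) simp
    then show "((\<lambda>k. indicator {0..1} k * k powr (1 - \<beta>)) has_integral (1 / (2 - \<beta>))) UNIV"
      by (rule has_integral_eq[rotated]) (auto simp: indicator_def)
  qed (auto simp: indicator_def)
  have 2: "(\<integral>\<^sup>+k. ennreal (indicator {1..} k * k powr (- 1 - \<beta>)) \<partial>lborel) = ennreal (1 / \<beta>)"
  proof (rule nn_integral_has_integral_lborel)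
    have "((\<lambda>k. k powr (- 1 - \<beta>)) has_integral (- (1 powr (- 1 - \<beta> + 1)) / (- 1 - \<beta> + 1))) {1..}"
      using \<beta> by (intro has_integral_powr_to_inf) auto
    then have "((\<lambda>k. if k \<in> {1..} then k powr (- 1 - \<beta>) else 0) has_integral (1 / \<beta>)) UNIV"
      by (subst has_integral_restrict_UNIV) simp
    then show "((\<lambda>k. indicator {1..} k * k powr (- 1 - \<beta>)) has_integral (1 / \<beta>)) UNIV"
      by (rule has_integral_eq[rotated]) (auto simp: indicator_def)
  qed (auto simp: indicator_def)
  have g: "(\<integral>\<^sup>+k. ?g k \<partial>lborel) < top"
    by (subst nn_integral_add) (auto simp: 1 2)
  \<comment> \<open>\<open>?g\<close> majorises only on the right half-line; its reflection takes
    care of negative \<open>k\<close>. The form \<open>0 + - 1 * k\<close> is that of an affine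
    substitution.\<close>
  have fg: "?f k \<le> ?g k + ?g (0 + - 1 * k)" for k
  proof -
    have pos: "?f j \<le> ?g j" if "j \<ge> 0" for j :: real
    proof (cases "j \<le> 1")
      case True
      have "min 1 (j\<^sup>2) * j powr (- 1 - \<beta>) \<le> j\<^sup>2 * j powr (- 1 - \<beta>)"
        by (intro mult_right_mono) auto
      also have "\<dots> = j powr (1 - \<beta>)"
        using that powr_add[of j 2 "- 1 - \<beta>"] by (cases "j = 0") auto
      finally show ?thesis
        using that True by (intro add_increasing2) (auto intro!: ennreal_leI)
    next
      case False
      have "min 1 (j\<^sup>2) * j powr (- 1 - \<beta>) \<le> 1 * j powr (- 1 - \<beta>)"
        by (intro mult_right_mono) auto
      then show ?thesis
        using that False by (intro add_increasing) (auto intro!: ennreal_leI)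
    qed
    show ?thesis
    proof (cases "k \<ge> 0")
      case True
      from pos[OF this] show ?thesis by (rule order_trans) simp
    next
      case False
      then have "?f (0 + - 1 * k) \<le> ?g (0 + - 1 * k)" by (intro pos) simp
      then have "?f k \<le> ?g (0 + - 1 * k)" by simp
      then show ?thesis by (rule order_trans) simp
    qed
  qed
  have "(\<integral>\<^sup>+k. ?f k \<partial>lborel) \<le> (\<integral>\<^sup>+k. ?g k + ?g (0 + - 1 * k) \<partial>lborel)"
    by (intro nn_integral_mono fg)
  also have "\<dots> = (\<integral>\<^sup>+k. ?g k \<partial>lborel) + (\<integral>\<^sup>+k. ?g (0 + - 1 * k) \<partial>lborel)"
    by (intro nn_integral_add) measurable
  also have "(\<integral>\<^sup>+k. ?g (0 + - 1 * k) \<partial>lborel) = (\<integral>\<^sup>+k. ?g k \<partial>lborel)"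
    using nn_integral_real_affine[of ?g "-1" 0] by simp
  also have "(\<integral>\<^sup>+k. ?g k \<partial>lborel) + (\<integral>\<^sup>+k. ?g k \<partial>lborel) < top"
    using g by (simp add: ennreal_add_less_top)
  finally show ?thesis .
qed

subsection \<open>The fractional Hardy inequality\<close>

text \<open>At \<open>y = 0\<close> the quotient is 0, because \<open>0 powr \<beta> = 0\<close> and
  division by 0 gives 0. A single point does not affect the integral.\<close>

definition hardy_sq :: "real \<Rightarrow> (real \<Rightarrow> real) \<Rightarrow> ennreal" where
  "hardy_sq \<beta> u = (\<integral>\<^sup>+ y. ennreal ((u y)\<^sup>2 / \<bar>y\<bar> powr \<beta>) \<partial>lborel)"

lemma hardy_sq_dilate:
  assumes [measurable]: "u \<in> borel_measurable borel" and t: "t > 0"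
  shows "hardy_sq \<beta> (\<lambda>y. u (t * y)) = ennreal (t powr (\<beta> - 1)) * hardy_sq \<beta> u"
proof -
  have "hardy_sq \<beta> u = ennreal \<bar>t\<bar> * (\<integral>\<^sup>+ y. ennreal ((u (0 + t * y))\<^sup>2 / \<bar>0 + t * y\<bar> powr \<beta>) \<partial>lborel)"
    unfolding hardy_sq_def using t by (intro nn_integral_real_affine) auto
  also have "\<dots> = ennreal \<bar>t\<bar> * (\<integral>\<^sup>+ y. ennreal (t powr (- \<beta>)) * ennreal ((u (t * y))\<^sup>2 / \<bar>y\<bar> powr \<beta>) \<partial>lborel)"
    using t by (simp add: abs_mult powr_mult powr_minus divide_simps flip: ennreal_mult')
  also have "\<dots> = ennreal \<bar>t\<bar> * (ennreal (t powr (- \<beta>)) * hardy_sq \<beta> (\<lambda>y. u (t * y)))"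
    unfolding hardy_sq_def by (subst nn_integral_cmult) auto
  also have "\<dots> = ennreal (t powr (1 - \<beta>)) * hardy_sq \<beta> (\<lambda>y. u (t * y))"
    using t powr_add[of t 1 "- \<beta>"] by (simp add: ennreal_mult' mult.assoc)
  finally have "ennreal (t powr (\<beta> - 1)) * hardy_sq \<beta> u
      = ennreal (t powr (\<beta> - 1) * t powr (1 - \<beta>)) * hardy_sq \<beta> (\<lambda>y. u (t * y))"
    by (simp add: ennreal_mult' mult.assoc)
  also have "t powr (\<beta> - 1) * t powr (1 - \<beta>) = 1"
    using t by (simp flip: powr_add)
  finally show ?thesis by simp
qed

text \<open>Young's inequality with a parameter: the factor of a^2 comes as close to 1 as desired,
  at the price of a large factor of b^2. Absorption needs exactly this.\<close>

lemma square_add_le_weighted: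
  fixes a b \<epsilon> :: real
  assumes "\<epsilon> > 0"
  shows "(a + b)\<^sup>2 \<le> (1 + \<epsilon>) * a\<^sup>2 + (1 + 1 / \<epsilon>) * b\<^sup>2"
proof -
  have "0 \<le> (\<epsilon> * a - b)\<^sup>2 / \<epsilon>" using assms by simp
  also have "\<dots> = \<epsilon> * a\<^sup>2 + b\<^sup>2 / \<epsilon> - 2 * a * b"
    using assms by (simp add: power2_eq_square field_simps)
  finally show ?thesis by (simp add: power2_eq_square algebra_simps)
qed

lemma hardy_sq_add_le:
  assumes [measurable]: "u \<in> borel_measurable borel" "v \<in> borel_measurable borel" and "\<epsilon> > 0"
  shows "hardy_sq \<beta> (\<lambda>y. u y + v y) \<le> ennreal (1 + \<epsilon>) * hardy_sq \<beta> u + ennreal (1 + 1 / \<epsilon>) * hardy_sq \<beta> v"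
proof -
  have "ennreal ((u y + v y)\<^sup>2 / \<bar>y\<bar> powr \<beta>) \<le>
      ennreal (1 + \<epsilon>) * ennreal ((u y)\<^sup>2 / \<bar>y\<bar> powr \<beta>)
      + ennreal (1 + 1 / \<epsilon>) * ennreal ((v y)\<^sup>2 / \<bar>y\<bar> powr \<beta>)" for y
  proof -
    have "(u y + v y)\<^sup>2 / \<bar>y\<bar> powr \<beta>
        \<le> ((1 + \<epsilon>) * (u y)\<^sup>2 + (1 + 1 / \<epsilon>) * (v y)\<^sup>2) / \<bar>y\<bar> powr \<beta>"
      by (intro divide_right_mono square_add_le_weighted assms) simp
    also have "\<dots> = (1 + \<epsilon>) * ((u y)\<^sup>2 / \<bar>y\<bar> powr \<beta>) + (1 + 1 / \<epsilon>) * ((v y)\<^sup>2 / \<bar>y\<bar> powr \<beta>)"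
      by (simp add: add_divide_distrib)
    finally have "ennreal ((u y + v y)\<^sup>2 / \<bar>y\<bar> powr \<beta>)
        \<le> ennreal ((1 + \<epsilon>) * ((u y)\<^sup>2 / \<bar>y\<bar> powr \<beta>) + (1 + 1 / \<epsilon>) * ((v y)\<^sup>2 / \<bar>y\<bar> powr \<beta>))"
      by (rule ennreal_leI)
    also have "\<dots> = ennreal ((1 + \<epsilon>) * ((u y)\<^sup>2 / \<bar>y\<bar> powr \<beta>)) + ennreal ((1 + 1 / \<epsilon>) * ((v y)\<^sup>2 / \<bar>y\<bar> powr \<beta>))"
      using assms by (intro ennreal_plus mult_nonneg_nonneg) auto
    also have "\<dots> = ennreal (1 + \<epsilon>) * ennreal ((u y)\<^sup>2 / \<bar>y\<bar> powr \<beta>)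
      + ennreal (1 + 1 / \<epsilon>) * ennreal ((v y)\<^sup>2 / \<bar>y\<bar> powr \<beta>)"
      using assms by (intro arg_cong2[where f = "(+)"] ennreal_mult') auto
    finally show ?thesis .
  qed
  then have "hardy_sq \<beta> (\<lambda>y. u y + v y) \<le>
    (\<integral>\<^sup>+ y. ennreal (1 + \<epsilon>) * ennreal ((u y)\<^sup>2 / \<bar>y\<bar> powr \<beta>)
      + ennreal (1 + 1 / \<epsilon>) * ennreal ((v y)\<^sup>2 / \<bar>y\<bar> powr \<beta>) \<partial>lborel)"
    unfolding hardy_sq_def by (rule nn_integral_mono)
  also have "\<dots> = ennreal (1 + \<epsilon>) * hardy_sq \<beta> u + ennreal (1 + 1 / \<epsilon>) * hardy_sq \<beta> v"
    unfolding hardy_sq_def by (simp add: nn_integral_add nn_integral_cmult)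
  finally show ?thesis .
qed

lemma hardy_sq_uminus: "hardy_sq \<beta> (\<lambda>y. - u y) = hardy_sq \<beta> u"
  by (simp add: hardy_sq_def)

text \<open>This is where \<open>\<beta> \<noteq> 1\<close> enters: otherwise the weighted norm is invariant under dilations.\<close>

lemma hardy_sq_le_dilation_increment:
  assumes "\<beta> \<noteq> 1"
  obtains C :: real where "C > 0"
    "\<And>u t. u \<in> borel_measurable borel \<Longrightarrow> hardy_sq \<beta> u < top \<Longrightarrow> t \<ge> 2 \<Longrightarrow>
      hardy_sq \<beta> u \<le> ennreal C * hardy_sq \<beta> (\<lambda>y. u (t * y) - u y)"
proof -
  \<comment> \<open>The dilation factor \<open>t powr (\<beta> - 1)\<close> at t = 2. Over t \<ge> 2
    this is the value closest to 1, whether the factor increases or decreases in t.\<close>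
  define \<kappa> :: real where "\<kappa> = 2 powr (\<beta> - 1)"
  have \<kappa>: "\<kappa> > 0" by (simp add: \<kappa>_def)
  \<comment> \<open>Half of the gap between \<open>\<kappa>\<close> and 1 is spent on
    \<open>\<epsilon>\<close>, and \<open>\<delta>\<close> is what remains:
    \<open>\<kappa> - (1 + \<epsilon>) = \<delta>\<close> for \<beta> > 1, and
    \<open>1 - (1 + \<epsilon>) * \<kappa> = \<delta>\<close> for \<beta> < 1.\<close>
  define \<epsilon> where "\<epsilon> = (if \<beta> > 1 then (\<kappa> - 1) / 2 else (1 / \<kappa> - 1) / 2)"
  define \<delta> where "\<delta> = (if \<beta> > 1 then (\<kappa> - 1) / 2 else (1 - \<kappa>) / 2)"
  have \<kappa>1: "\<beta> > 1 \<Longrightarrow> \<kappa> > 1" "\<not> \<beta> > 1 \<Longrightarrow> \<kappa> < 1"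
    using assms by (auto simp: \<kappa>_def powr_less_one)
  then have pos: "\<epsilon> > 0" "\<delta> > 0" using \<kappa>
    by (auto simp: \<epsilon>_def \<delta>_def)
  have key: "hardy_sq \<beta> u \<le> ennreal ((1 + 1 / \<epsilon>) / \<delta>) * hardy_sq \<beta> (\<lambda>y. u (t * y) - u y)"
    if [measurable]: "u \<in> borel_measurable borel" and fin: "hardy_sq \<beta> u < top" and t: "t \<ge> 2" for u and t :: real
  proof (cases "hardy_sq \<beta> (\<lambda>y. u (t * y) - u y)" rule: ennreal_cases)
    case top
    have "(1 + 1 / \<epsilon>) / \<delta> > 0"
      using pos by (intro divide_pos_pos add_pos_pos) auto
    then have "ennreal ((1 + 1 / \<epsilon>) / \<delta>) \<noteq> 0"
      by (simp only: ennreal_eq_0_iff not_le)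
    then have "ennreal ((1 + 1 / \<epsilon>) / \<delta>) * top = top"
      by (simp only: ennreal_mult_eq_top_iff) simp
    with top show ?thesis by simp
  next
    case (real d)
    define D where "D = hardy_sq \<beta> (\<lambda>y. u (t * y) - u y)"
    \<comment> \<open>Absorption subtracts a multiple of the weighted integral from both sides, so
      it is carried out in the reals. Here the finiteness of \<open>hardy_sq \<beta> u\<close>
      enters.\<close>
    obtain w where w: "w \<ge> 0" "hardy_sq \<beta> u = ennreal w"
      using fin by (cases "hardy_sq \<beta> u" rule: ennreal_cases) auto
    define \<tau> where "\<tau> = t powr (\<beta> - 1)"
    have dil: "hardy_sq \<beta> (\<lambda>y. u (t * y)) = ennreal (\<tau> * w)"
      using t w by (simp add: hardy_sq_dilate \<tau>_def ennreal_mult')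
    have eqs: "ennreal a * ennreal x + ennreal b * ennreal y = ennreal (a * x + b * y)"
      if "a \<ge> 0" "b \<ge> 0" "x \<ge> 0" "y \<ge> 0" for a b x y
      using that by (simp add: ennreal_mult' ennreal_plus)
    have "\<delta> * w \<le> (1 + 1 / \<epsilon>) * d"
    proof (cases "\<beta> > 1")
      case True
      have "hardy_sq \<beta> (\<lambda>y. u (t * y)) \<le> ennreal (1 + \<epsilon>) * hardy_sq \<beta> u + ennreal (1 + 1 / \<epsilon>) * hardy_sq \<beta> (\<lambda>y. u (t * y) - u y)"
        using hardy_sq_add_le[of u "\<lambda>y. u (t * y) - u y" \<epsilon> \<beta>] pos by simp
      moreover have "ennreal (1 + \<epsilon>) * ennreal w + ennreal (1 + 1 / \<epsilon>) * ennreal d = ennreal ((1 + \<epsilon>) * w + (1 + 1 / \<epsilon>) * d)"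
        using pos w real by (intro eqs) auto
      ultimately have "ennreal (\<tau> * w) \<le> ennreal ((1 + \<epsilon>) * w + (1 + 1 / \<epsilon>) * d)"
        by (simp only: dil w(2) real)
      then have "\<tau> * w \<le> (1 + \<epsilon>) * w + (1 + 1 / \<epsilon>) * d"
        using pos w real by (subst (asm) ennreal_le_iff) auto
      moreover have "\<kappa> * w \<le> \<tau> * w"
        using t w True by (intro mult_right_mono) (auto simp: \<kappa>_def \<tau>_def intro!: powr_mono2)
      ultimately show ?thesis
        using True by (simp add: \<epsilon>_def \<delta>_def field_simps)
    next
      \<comment> \<open>For \<beta> < 1 dilation shrinks the weighted integral, so \<open>u\<close>
        and its dilate exchange roles: \<open>u\<close> is now the sum that gets estimated.\<close>
      case False
      have "hardy_sq \<beta> u \<le> ennreal (1 + \<epsilon>) * hardy_sq \<beta> (\<lambda>y. u (t * y)) + ennreal (1 + 1 / \<epsilon>) * hardy_sq \<beta> (\<lambda>y. u (t * y) - u y)"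
        using hardy_sq_add_le[of "\<lambda>y. u (t * y)" "\<lambda>y. - (u (t * y) - u y)" \<epsilon> \<beta>] pos
        by (simp only: hardy_sq_uminus) simp
      moreover have "ennreal (1 + \<epsilon>) * ennreal (\<tau> * w) + ennreal (1 + 1 / \<epsilon>) * ennreal d = ennreal ((1 + \<epsilon>) * (\<tau> * w) + (1 + 1 / \<epsilon>) * d)"
        using pos w real by (intro eqs) (auto simp: \<tau>_def)
      ultimately have "ennreal w \<le> ennreal ((1 + \<epsilon>) * (\<tau> * w) + (1 + 1 / \<epsilon>) * d)"
        by (simp only: dil w(2) real)
      then have "w \<le> (1 + \<epsilon>) * (\<tau> * w) + (1 + 1 / \<epsilon>) * d"
        using pos w real by (subst (asm) ennreal_le_iff) (auto simp: \<tau>_def)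
      moreover have "(1 + \<epsilon>) * (\<tau> * w) \<le> (1 + \<epsilon>) * (\<kappa> * w)"
        using t w False pos by (intro mult_right_mono mult_left_mono) (auto simp: \<kappa>_def \<tau>_def intro!: powr_mono2')
      moreover have "(1 + \<epsilon>) * (\<kappa> * w) = (1 - \<delta>) * w"
        using False \<kappa> by (simp add: \<epsilon>_def \<delta>_def field_simps)
      ultimately show ?thesis
        by (simp add: algebra_simps)
    qed
    then have "w \<le> (1 + 1 / \<epsilon>) / \<delta> * d"
      using pos by (simp add: field_simps)
    then show ?thesis
      using pos real w by (simp flip: ennreal_mult' ) 
  qed
  show thesis
    by (rule that[of "(1 + 1 / \<epsilon>) / \<delta>"]) (use pos key in \<open>auto simp: add_pos_pos\<close>)
qed

text \<open>For t in [2, 4] the distance |t * y - y| = |y| (t - 1) is at most 3 |y|, which is the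
  origin of \<open>3 powr (1 + \<beta>)\<close>. The Jacobian |y| of \<open>y' = t * y\<close>
  supplies the missing power, since |y|^(-\<beta>) = |y| * |y|^(-1 - \<beta>). The factor 2 undoes
  the 1/2 in the energy.\<close>

lemma nn_integral_hardy_sq_dilation_increment_le:
  assumes [measurable]: "u \<in> borel_measurable borel" and \<beta>: "\<beta> \<in> {0<..<2}"
  shows "(\<integral>\<^sup>+t. indicator {2..4} t * hardy_sq \<beta> (\<lambda>y. u (t * y) - u y) \<partial>lborel)
    \<le> ennreal (3 powr (1 + \<beta>) / q_const \<beta>) * (2 * energy \<beta> u)"
proof -
  define K where "K = 3 powr (1 + \<beta>) / q_const \<beta>"
  have q: "q_const \<beta> > 0" and K: "K > 0" using q_const_pos[OF \<beta>] by (auto simp: K_def)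
  have "(\<integral>\<^sup>+t. indicator {2..4} t * hardy_sq \<beta> (\<lambda>y. u (t * y) - u y) \<partial>lborel)
      = (\<integral>\<^sup>+t. \<integral>\<^sup>+y. indicator {2..4} t * ennreal ((u (t * y) - u y)\<^sup>2 / \<bar>y\<bar> powr \<beta>) \<partial>lborel \<partial>lborel)"
    unfolding hardy_sq_def by (intro nn_integral_cong nn_integral_cmult[symmetric]) measurable
  also have "\<dots> = (\<integral>\<^sup>+y. \<integral>\<^sup>+t. indicator {2..4} t * ennreal ((u (t * y) - u y)\<^sup>2 / \<bar>y\<bar> powr \<beta>) \<partial>lborel \<partial>lborel)"
    by (rule lborel_pair.Fubini') measurable
  also have "\<dots> \<le> (\<integral>\<^sup>+y. ennreal K * (\<integral>\<^sup>+y'. ennreal ((u y' - u y)\<^sup>2 * q_kernel \<beta> (y' - y)) \<partial>lborel) \<partial>lborel)"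
  proof (rule nn_integral_mono)
    fix y :: real
    show "(\<integral>\<^sup>+t. indicator {2..4} t * ennreal ((u (t * y) - u y)\<^sup>2 / \<bar>y\<bar> powr \<beta>) \<partial>lborel)
       \<le> ennreal K * (\<integral>\<^sup>+y'. ennreal ((u y' - u y)\<^sup>2 * q_kernel \<beta> (y' - y)) \<partial>lborel)"
    proof (cases "y = 0")
      case True
      then show ?thesis by simp
    next
      case False
      have "(\<integral>\<^sup>+t. indicator {2..4} t * ennreal ((u (t * y) - u y)\<^sup>2 / \<bar>y\<bar> powr \<beta>) \<partial>lborel)
        \<le> (\<integral>\<^sup>+t. ennreal (K * \<bar>y\<bar>) * ennreal ((u (0 + y * t) - u y)\<^sup>2 * q_kernel \<beta> (0 + y * t - y)) \<partial>lborel)"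
      proof (rule nn_integral_mono)
        fix t :: real
        show "indicator {2..4} t * ennreal ((u (t * y) - u y)\<^sup>2 / \<bar>y\<bar> powr \<beta>)
          \<le> ennreal (K * \<bar>y\<bar>) * ennreal ((u (0 + y * t) - u y)\<^sup>2 * q_kernel \<beta> (0 + y * t - y))"
        proof (cases "t \<in> {2..4}")
          case True
          have "1 / \<bar>y\<bar> powr \<beta> = 3 powr (1 + \<beta>) * \<bar>y\<bar> * (\<bar>y\<bar> powr (- 1 - \<beta>) * 3 powr (- 1 - \<beta>))"
            using False powr_add[of "\<bar>y\<bar>" 1 "- 1 - \<beta>"] powr_add[of 3 "1 + \<beta>" "- 1 - \<beta>"]
            by (simp add: powr_minus field_simps)
          also have "\<dots> \<le> 3 powr (1 + \<beta>) * \<bar>y\<bar> * (\<bar>y\<bar> powr (- 1 - \<beta>) * (t - 1) powr (- 1 - \<beta>))"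
            using True \<beta> by (intro mult_left_mono powr_mono2') auto
          also have "\<bar>y\<bar> powr (- 1 - \<beta>) * (t - 1) powr (- 1 - \<beta>) = \<bar>y * t - y\<bar> powr (- 1 - \<beta>)"
          proof -
            have "\<bar>y * t - y\<bar> = \<bar>y\<bar> * (t - 1)"
              using True abs_mult[of y "t - 1"] by (simp add: right_diff_distrib)
            then show ?thesis using True by (simp add: powr_mult)
          qed
          also have "3 powr (1 + \<beta>) * \<bar>y\<bar> * \<bar>y * t - y\<bar> powr (- 1 - \<beta>) = K * \<bar>y\<bar> * q_kernel \<beta> (y * t - y)"
            using q by (simp add: K_def q_kernel_def)
          finally have "(u (t * y) - u y)\<^sup>2 * (1 / \<bar>y\<bar> powr \<beta>) \<le> (u (t * y) - u y)\<^sup>2 * (K * \<bar>y\<bar> * q_kernel \<beta> (y * t - y))"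
            by (rule mult_left_mono) simp
          then show ?thesis
            using True K by (simp flip: ennreal_mult' add: mult_ac ennreal_leI)
        qed simp
      qed
      also have "\<dots> = ennreal K * (ennreal \<bar>y\<bar> * (\<integral>\<^sup>+t. ennreal ((u (0 + y * t) - u y)\<^sup>2 * q_kernel \<beta> (0 + y * t - y)) \<partial>lborel))"
        using K by (subst nn_integral_cmult) (auto simp: ennreal_mult' mult.assoc)
      also have "\<dots> = ennreal K * (\<integral>\<^sup>+y'. ennreal ((u y' - u y)\<^sup>2 * q_kernel \<beta> (y' - y)) \<partial>lborel)"
        using False by (subst nn_integral_real_affine[of _ y 0]) auto
      finally show ?thesis .
    qed
  qed
  also have "\<dots> = ennreal K * (\<integral>\<^sup>+y. \<integral>\<^sup>+y'. ennreal ((u y' - u y)\<^sup>2 * q_kernel \<beta> (y' - y)) \<partial>lborel \<partial>lborel)"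
    by (rule nn_integral_cmult) measurable
  also have "\<dots> = ennreal K * (2 * energy \<beta> u)"
    by (simp add: energy_eq_iterated mult.assoc[symmetric] ennreal_times_divide)
  finally show ?thesis by (simp add: K_def)
qed

theorem fractional_hardy_inequality:
  assumes \<beta>: "\<beta> \<in> {0<..<2}" "\<beta> \<noteq> 1"
  obtains C :: real where "C > 0"
    "\<And>u. u \<in> borel_measurable borel \<Longrightarrow> hardy_sq \<beta> u < top \<Longrightarrow> hardy_sq \<beta> u \<le> ennreal C * energy \<beta> u"
proof -
  obtain C :: real where C: "C > 0"
    "\<And>u t. u \<in> borel_measurable borel \<Longrightarrow> hardy_sq \<beta> u < top \<Longrightarrow> t \<ge> 2 \<Longrightarrow>
      hardy_sq \<beta> u \<le> ennreal C * hardy_sq \<beta> (\<lambda>y. u (t * y) - u y)"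
    using hardy_sq_le_dilation_increment[OF \<beta>(2)] by blast
  define K where "K = 3 powr (1 + \<beta>) / q_const \<beta>"
  have K: "K > 0" using q_const_pos[OF \<beta>(1)] by (auto simp: K_def)
  have "hardy_sq \<beta> u \<le> ennreal (C * K * 2) * energy \<beta> u"
    if [measurable]: "u \<in> borel_measurable borel" and fin: "hardy_sq \<beta> u < top" for u
  proof -
    \<comment> \<open>The factor 2 is the length of the interval \<open>{2..4}\<close> over which
      the bound for a single dilation gets averaged.\<close>
    have "hardy_sq \<beta> u \<le> 2 * hardy_sq \<beta> u"
      using mult_right_mono[of 1 2 "hardy_sq \<beta> u"] by simp
    also have "\<dots> = (\<integral>\<^sup>+t. hardy_sq \<beta> u * indicator {2..4::real} t \<partial>lborel)"
      by (simp add: nn_integral_cmult_indicator mult.commute)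
    also have "\<dots> \<le> (\<integral>\<^sup>+t. ennreal C * (indicator {2..4} t * hardy_sq \<beta> (\<lambda>y. u (t * y) - u y)) \<partial>lborel)"
      by (intro nn_integral_mono) (auto simp: indicator_def intro!: C(2) fin)
    also have "\<dots> = ennreal C * (\<integral>\<^sup>+t. indicator {2..4} t * hardy_sq \<beta> (\<lambda>y. u (t * y) - u y) \<partial>lborel)"
      unfolding hardy_sq_def by (rule nn_integral_cmult) measurable
    also have "\<dots> \<le> ennreal C * (ennreal K * (2 * energy \<beta> u))"
      unfolding K_def by (intro mult_left_mono nn_integral_hardy_sq_dilation_increment_le that \<beta>) simp
    also have "\<dots> = ennreal (C * K * 2) * energy \<beta> u"
      using C K by (simp add: ennreal_mult' mult.assoc)
    finally show ?thesis .
  qed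
  then show thesis
    using C K by (intro that[of "C * K * 2"]) auto
qed

subsection \<open>Limits of test functions\<close>

lemma L2_sq_finite_if_bounded_support:
  assumes bd: "\<And>x. \<bar>\<phi> x\<bar> \<le> M" and supp: "\<And>x. \<bar>x\<bar> > R \<Longrightarrow> \<phi> x = 0"
  shows "L2_sq \<phi> < top"
proof -
  have "L2_sq \<phi> \<le> (\<integral>\<^sup>+y. ennreal (M\<^sup>2) * indicator {- R..R} y \<partial>lborel)"
    unfolding L2_sq_def
  proof (rule nn_integral_mono)
    fix y
    have "(\<phi> y)\<^sup>2 \<le> M\<^sup>2" using bd[of y] by (metis abs_le_square_iff abs_of_nonneg abs_ge_zero order_trans)
    then show "ennreal ((\<phi> y)\<^sup>2) \<le> ennreal (M\<^sup>2) * indicator {- R..R} y"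
      using supp[of y] by (cases "\<bar>y\<bar> \<le> R") (auto simp: indicator_def abs_le_iff intro: ennreal_leI)
  qed
  also have "\<dots> < top"
    by (simp add: nn_integral_cmult_indicator ennreal_mult_less_top emeasure_lborel_Icc_eq)
  finally show ?thesis .
qed

text \<open>The Lipschitz bound controls increments for small \<open>h\<close> and the sup bound for
  large \<open>h\<close>, which together give a multiple of \<open>min 1 (h\<^sup>2)\<close>. An
  increment vanishes unless \<open>y\<close> or \<open>y + h\<close> lies in [-R, R], so its squared
  L2 norm has a bound of the same form, and this is integrable against the kernel.\<close>

lemma energy_finite_if_lipschitz:
  fixes \<phi> :: "real \<Rightarrow> real"
  assumes [measurable]: "\<phi> \<in> borel_measurable borel" and \<beta>: "\<beta> \<in> {0<..<2}"
    and lip: "\<And>x y. \<bar>\<phi> x - \<phi> y\<bar> \<le> L * \<bar>x - y\<bar>"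
    and bd: "\<And>x. \<bar>\<phi> x\<bar> \<le> M" and supp: "\<And>x. \<bar>x\<bar> > R \<Longrightarrow> \<phi> x = 0"
  shows "energy \<beta> \<phi> < top"
proof -
  define C where "C = L\<^sup>2 + 4 * M\<^sup>2"
  have sq: "(\<phi> (y + h) - \<phi> y)\<^sup>2 \<le> C * min 1 (h\<^sup>2) * (indicator {- R..R} (y + h) + indicator {- R..R} y)" for y h
  proof (cases "\<bar>y + h\<bar> \<le> R \<or> \<bar>y\<bar> \<le> R")
    case True
    have "\<bar>\<phi> (y + h) - \<phi> y\<bar> \<le> \<bar>L\<bar> * \<bar>h\<bar>"
      using lip[of "y + h" y] by (smt (verit) abs_ge_zero abs_ge_self mult_right_mono add_diff_cancel_left')
    then have "(\<phi> (y + h) - \<phi> y)\<^sup>2 \<le> L\<^sup>2 * h\<^sup>2"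
      by (metis abs_le_square_iff abs_mult power_mult_distrib)
    then have 1: "(\<phi> (y + h) - \<phi> y)\<^sup>2 \<le> C * h\<^sup>2"
      unfolding C_def by (simp add: distrib_right add_increasing2)
    have "\<bar>\<phi> (y + h) - \<phi> y\<bar> \<le> \<bar>2 * M\<bar>"
      using bd[of "y + h"] bd[of y] by linarith
    then have "(\<phi> (y + h) - \<phi> y)\<^sup>2 \<le> (2 * M)\<^sup>2"
      by (simp add: abs_le_square_iff)
    then have 2: "(\<phi> (y + h) - \<phi> y)\<^sup>2 \<le> C"
      unfolding C_def by (simp add: power_mult_distrib add_increasing)
    have C: "C * min 1 (h\<^sup>2) \<ge> 0" by (simp add: C_def)
    have "(\<phi> (y + h) - \<phi> y)\<^sup>2 \<le> C * min 1 (h\<^sup>2) * 1"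
      using 1 2 by (simp add: min_def)
    also have "\<dots> \<le> C * min 1 (h\<^sup>2) * (indicator {- R..R} (y + h) + indicator {- R..R} y)"
      using True by (intro mult_left_mono C) (auto simp: indicator_def abs_le_iff)
    finally show ?thesis .
  qed (simp add: supp C_def)
  have inc: "L2_sq (\<lambda>y. \<phi> (y + h) - \<phi> y) \<le> ennreal (C * min 1 (h\<^sup>2)) * (2 * ennreal (R + R))" for h
  proof -
    have "L2_sq (\<lambda>y. \<phi> (y + h) - \<phi> y)
      \<le> (\<integral>\<^sup>+y. ennreal (C * min 1 (h\<^sup>2)) * (indicator {- R..R} (y + h) + indicator {- R..R} y) \<partial>lborel)"
      unfolding L2_sq_def
    proof (rule nn_integral_mono)
      fix y
      show "ennreal ((\<phi> (y + h) - \<phi> y)\<^sup>2)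
        \<le> ennreal (C * min 1 (h\<^sup>2)) * (indicator {- R..R} (y + h) + indicator {- R..R} y)"
        using ennreal_leI[OF sq[of y h]]
        by (subst (asm) ennreal_mult) (auto simp: C_def ennreal_plus ennreal_indicator)
    qed
    also have "\<dots> = ennreal (C * min 1 (h\<^sup>2)) * (2 * emeasure lborel {- R..R})"
      using nn_integral_lborel_shift[of "indicator {- R..R}" h]
      by (simp add: nn_integral_cmult nn_integral_add mult_2)
    \<comment> \<open>For R < 0 the interval is empty and \<open>ennreal (R + R)\<close> is 0, so
      the bound also holds then.\<close>
    finally show ?thesis
      by (cases "R \<ge> 0") (auto simp: emeasure_lborel_Icc_eq ennreal_neg)
  qed
  define D where "D = ennreal (q_const \<beta> * C) * (2 * ennreal (R + R))"
  have "(\<integral>\<^sup>+h. ennreal (q_kernel \<beta> h) * L2_sq (\<lambda>y. \<phi> (y + h) - \<phi> y) \<partial>lborel)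
    \<le> (\<integral>\<^sup>+h. D * ennreal (min 1 (h\<^sup>2) * \<bar>h\<bar> powr (- 1 - \<beta>)) \<partial>lborel)"
  proof (rule nn_integral_mono)
    fix h :: real
    have "ennreal (q_kernel \<beta> h) * L2_sq (\<lambda>y. \<phi> (y + h) - \<phi> y)
      \<le> ennreal (q_kernel \<beta> h) * (ennreal (C * min 1 (h\<^sup>2)) * (2 * ennreal (R + R)))"
      by (intro mult_left_mono inc) simp
    also have "\<dots> = ennreal (q_const \<beta> * C * (min 1 (h\<^sup>2) * \<bar>h\<bar> powr (- 1 - \<beta>))) * (2 * ennreal (R + R))"
      using q_kernel_nonneg[OF \<beta>, of h]
      by (subst mult.assoc[symmetric], subst ennreal_mult'[symmetric]) (auto simp: q_kernel_def mult_ac)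
    also have "\<dots> = D * ennreal (min 1 (h\<^sup>2) * \<bar>h\<bar> powr (- 1 - \<beta>))"
      using q_const_pos[OF \<beta>] unfolding D_def by (subst ennreal_mult') (auto simp: C_def mult_ac)
    finally show "ennreal (q_kernel \<beta> h) * L2_sq (\<lambda>y. \<phi> (y + h) - \<phi> y)
      \<le> D * ennreal (min 1 (h\<^sup>2) * \<bar>h\<bar> powr (- 1 - \<beta>))" .
  qed
  also have "\<dots> = D * (\<integral>\<^sup>+h. ennreal (min 1 (h\<^sup>2) * \<bar>h\<bar> powr (- 1 - \<beta>)) \<partial>lborel)"
    by (rule nn_integral_cmult) measurable
  also have "\<dots> < top"
    using nn_integral_min_powr_finite[OF \<beta>] by (simp add: D_def ennreal_mult_less_top)
  finally show ?thesis
    by (simp only: energy_eq_increments[OF assms(1) \<beta>] ennreal_half_less_top_iff)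
qed

text \<open>Extracts from smoothness and compact support what the energy estimates use. The
  derivative is continuous and vanishes off the support, hence is bounded, and the mean value
  theorem gives the Lipschitz constant.\<close>

lemma test_function_cases:
  assumes "\<phi> \<in> test_functions U"
  obtains L M R where "\<phi> \<in> borel_measurable borel"
    "\<And>x y. \<bar>\<phi> x - \<phi> y\<bar> \<le> L * \<bar>x - y\<bar>" "\<And>x. \<bar>\<phi> x\<bar> \<le> M" "\<And>x. \<bar>x\<bar> > R \<Longrightarrow> \<phi> x = 0"
proof -
  define K where "K = closure {x. \<phi> x \<noteq> 0}"
  have smooth: "(deriv ^^ n) \<phi> differentiable_on UNIV" for n
    using assms by (auto simp: test_functions_def)
  have K: "compact K"
    using assms by (auto simp: test_functions_def K_def)
  have d0: "\<phi> differentiable_on UNIV" and d1: "deriv \<phi> differentiable_on UNIV"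
    using smooth[of 0] smooth[of 1] by auto
  have cont: "continuous_on UNIV \<phi>" "continuous_on UNIV (deriv \<phi>)"
    using d0 d1 by (auto intro: differentiable_imp_continuous_on)
  have der: "(\<phi> has_field_derivative deriv \<phi> x) (at x)" for x
    using d0 by (metis DERIV_deriv_iff_real_differentiable UNIV_I differentiable_on_def)
  have out: "\<phi> x = 0" if "x \<notin> K" for x
    using that closure_subset by (force simp: K_def)
  have dout: "deriv \<phi> x = 0" if "x \<notin> K" for x
  proof -
    have "((\<lambda>_. 0) has_field_derivative deriv \<phi> x) (at x)"
      by (rule has_field_derivative_transform_within_open[OF der, of "- K"])
        (use K that out in \<open>auto simp: compact_imp_closed open_Compl\<close>)
    then show ?thesis by (auto dest: DERIV_unique[OF _ DERIV_const])
  qed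
  obtain R where R: "\<And>x. x \<in> K \<Longrightarrow> \<bar>x\<bar> \<le> R"
    using K compact_imp_bounded by (fastforce simp: bounded_iff)
  obtain M where M: "\<And>x. x \<in> K \<Longrightarrow> \<bar>\<phi> x\<bar> \<le> M"
    using compact_imp_bounded[OF compact_continuous_image[OF continuous_on_subset[OF cont(1)] K]]
    by (auto simp: bounded_iff)
  obtain L where L: "\<And>x. x \<in> K \<Longrightarrow> \<bar>deriv \<phi> x\<bar> \<le> L"
    using compact_imp_bounded[OF compact_continuous_image[OF continuous_on_subset[OF cont(2)] K]]
    by (auto simp: bounded_iff)
  show thesis
  \<comment> \<open>The absolute values matter when \<open>K\<close> is empty: bounds over
    \<open>K\<close> then say nothing about the signs of \<open>L\<close> and
    \<open>M\<close>.\<close>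
  proof (rule that[of "\<bar>L\<bar>" "\<bar>M\<bar>" R])
    show "\<phi> \<in> borel_measurable borel"
      using cont(1) by (rule borel_measurable_continuous_onI)
    show "\<bar>\<phi> x - \<phi> y\<bar> \<le> \<bar>L\<bar> * \<bar>x - y\<bar>" for x y
    proof -
      have "norm (\<phi> x - \<phi> y) \<le> \<bar>L\<bar> * norm (x - y)"
      proof (rule field_differentiable_bound[of UNIV])
        fix z
        show "(\<phi> has_field_derivative deriv \<phi> z) (at z within UNIV)" using der by simp
        show "norm (deriv \<phi> z) \<le> \<bar>L\<bar>"
          using L[of z] dout[of z] by (cases "z \<in> K") auto
      qed auto
      then show ?thesis by simp
    qed
    show "\<bar>\<phi> x\<bar> \<le> \<bar>M\<bar>" for x using M[of x] out[of x] by (cases "x \<in> K") auto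
    show "\<phi> x = 0" if "\<bar>x\<bar> > R" for x using R[of x] out[of x] that by force
  qed
qed

lemma test_function_in_sobolev_H:
  assumes "\<phi> \<in> test_functions U" "\<beta> \<in> {0<..<2}"
  shows "\<phi> \<in> sobolev_H \<beta>"
proof -
  obtain L M R where *: "\<phi> \<in> borel_measurable borel"
    "\<And>x y. \<bar>\<phi> x - \<phi> y\<bar> \<le> L * \<bar>x - y\<bar>" "\<And>x. \<bar>\<phi> x\<bar> \<le> M" "\<And>x. \<bar>x\<bar> > R \<Longrightarrow> \<phi> x = 0"
    using test_function_cases[OF assms(1)] by blast
  show ?thesis
    using L2_sq_finite_if_bounded_support[of \<phi> M R] energy_finite_if_lipschitz[of \<phi> \<beta> L M R] * assms(2)
    by (simp add: sobolev_H_def)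
qed

text \<open>Serves twice: for finiteness on test functions, and for the approximation error once the
  weight has been truncated near 0.\<close>

lemma hardy_sq_le_L2_sq:
  assumes [measurable]: "u \<in> borel_measurable borel" and "r > 0" "\<beta> > 0" and "\<And>y. \<bar>y\<bar> < r \<Longrightarrow> u y = 0"
  shows "hardy_sq \<beta> u \<le> ennreal (r powr (- \<beta>)) * L2_sq u"
proof -
  have "hardy_sq \<beta> u \<le> (\<integral>\<^sup>+y. ennreal (r powr (- \<beta>)) * ennreal ((u y)\<^sup>2) \<partial>lborel)"
    unfolding hardy_sq_def
  proof (rule nn_integral_mono)
    fix y
    show "ennreal ((u y)\<^sup>2 / \<bar>y\<bar> powr \<beta>) \<le> ennreal (r powr (- \<beta>)) * ennreal ((u y)\<^sup>2)"
    proof (cases "\<bar>y\<bar> < r")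
      case False
      have "(u y)\<^sup>2 * \<bar>y\<bar> powr (- \<beta>) \<le> (u y)\<^sup>2 * r powr (- \<beta>)"
        using False assms by (intro mult_left_mono powr_mono2') auto
      then show ?thesis
        by (simp add: powr_minus field_simps ennreal_leI flip: ennreal_mult')
    qed (simp add: assms)
  qed
  then show ?thesis
    unfolding L2_sq_def by (simp add: nn_integral_cmult)
qed

lemma test_function_hardy_sq_finite:
  assumes \<phi>: "\<phi> \<in> test_functions (- {0})" and \<beta>: "\<beta> \<in> {0<..<2}"
  shows "hardy_sq \<beta> \<phi> < top"
proof -
  have "open (- closure {x. \<phi> x \<noteq> 0})" "0 \<in> - closure {x. \<phi> x \<noteq> 0}"
    using \<phi> by (auto simp: test_functions_def)
  then obtain r where r: "r > 0" "ball 0 r \<subseteq> - closure {x. \<phi> x \<noteq> 0}"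
    by (auto simp: open_contains_ball)
  have H: "\<phi> \<in> sobolev_H \<beta>" using test_function_in_sobolev_H[OF \<phi> \<beta>] .
  have "hardy_sq \<beta> \<phi> \<le> ennreal (r powr (- \<beta>)) * L2_sq \<phi>"
  proof (rule hardy_sq_le_L2_sq)
    fix y :: real assume "\<bar>y\<bar> < r"
    then have "y \<notin> closure {x. \<phi> x \<noteq> 0}" using r(2) by auto
    then show "\<phi> y = 0" using closure_subset by force
  qed (use H r \<beta> in \<open>auto simp: sobolev_H_def\<close>)
  also have "\<dots> < top"
    using H by (simp add: sobolev_H_def ennreal_mult_less_top)
  finally show ?thesis .
qed

section \<open>Passing the weighted bound to limits\<close>

lemma hardy_sq_truncation_LIMSEQ:
  assumes [measurable]: "u \<in> borel_measurable borel"
  shows "(\<lambda>k. hardy_sq \<beta> (\<lambda>y. u y * indicator {y. \<bar>y\<bar> \<ge> inverse (real (Suc k))} y)) \<longlonglongrightarrow> hardy_sq \<beta> u"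
  unfolding hardy_sq_def
proof (rule nn_integral_LIMSEQ)
  let ?f = "\<lambda>k y. ennreal ((u y * indicator {y. inverse (real (Suc k)) \<le> \<bar>y\<bar>} y)\<^sup>2 / \<bar>y\<bar> powr \<beta>)"
  show "incseq ?f"
  proof (rule incseq_SucI, rule le_funI)
    fix k y
    have le: "inverse (real (Suc (Suc k))) \<le> inverse (real (Suc k))"
      by (rule le_imp_inverse_le) auto
    show "?f k y \<le> ?f (Suc k) y"
    proof (cases "inverse (real (Suc k)) \<le> \<bar>y\<bar>")
      case True
      with order_trans[OF le this] show ?thesis by (simp del: of_nat_Suc)
    qed (simp del: of_nat_Suc)
  qed
  show "?f k \<in> borel_measurable lborel" for k by measurable
  show "(\<lambda>k. ?f k y) \<longlonglongrightarrow> ennreal ((u y)\<^sup>2 / \<bar>y\<bar> powr \<beta>)" for y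
  proof (cases "y = 0")
    case False
    have "eventually (\<lambda>k. inverse (real (Suc k)) < \<bar>y\<bar>) sequentially"
      using order_tendstoD(2)[OF LIMSEQ_inverse_real_of_nat, of "\<bar>y\<bar>"] False by simp
    then have "eventually (\<lambda>k. ?f k y = ennreal ((u y)\<^sup>2 / \<bar>y\<bar> powr \<beta>)) sequentially"
      by eventually_elim (simp add: less_imp_le)
    then show ?thesis by (rule tendsto_eventually)
  qed simp
qed

lemma sobolev_H_diff:
  assumes "u \<in> sobolev_H \<beta>" "v \<in> sobolev_H \<beta>" "\<beta> \<in> {0<..<2}"
  shows "(\<lambda>y. u y - v y) \<in> sobolev_H \<beta>"
proof -
  have [measurable]: "u \<in> borel_measurable borel" "v \<in> borel_measurable borel"
    using assms by (auto simp: sobolev_H_def)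
  have "L2_sq (\<lambda>y. u y - v y) < top"
    by (rule le_less_trans[OF L2_sq_diff_le]) (use assms in \<open>auto simp: sobolev_H_def ennreal_mult_less_top\<close>)
  moreover have "energy \<beta> (\<lambda>y. u y - v y) < top"
    by (rule le_less_trans[OF energy_diff_le]) (use assms in \<open>auto simp: sobolev_H_def ennreal_mult_less_top\<close>)
  ultimately show ?thesis by (simp add: sobolev_H_def)
qed

text \<open>A small value of \<open>sobolev_norm\<close> could also come from
  \<open>enn2real\<close> sending infinity to 0. Membership in \<open>sobolev_H\<close> excludes
  this and allows the return to \<open>ennreal\<close>.\<close>

lemma sobolev_norm_tendsto_0_imp_small:
  assumes w: "\<And>n::nat. w n \<in> sobolev_H \<beta>" and lim: "(\<lambda>n. sobolev_norm \<beta> (w n)) \<longlonglongrightarrow> 0" and "c > 0"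
  obtains n where "L2_sq (w n) \<le> ennreal c" "energy \<beta> (w n) \<le> ennreal c"
proof -
  obtain n where n: "sobolev_norm \<beta> (w n) < sqrt c"
    using order_tendstoD(2)[OF lim, of "sqrt c"] \<open>c > 0\<close> by (auto dest: eventually_happens)
  have "L2_sq (w n) + energy \<beta> (w n) < top"
    using w[of n] by (simp add: sobolev_H_def)
  then have "L2_sq (w n) + energy \<beta> (w n) = ennreal (enn2real (L2_sq (w n) + energy \<beta> (w n)))"
    by simp
  also have "\<dots> \<le> ennreal c"
    using n by (intro ennreal_leI) (simp add: sobolev_norm_def)
  finally show thesis
    by (intro that[of n]; elim order_trans[rotated]) auto
qed

text \<open>The order of choices is essential: the truncation radius \<open>r\<close> is fixed
  first, the approximant \<open>\<phi> n\<close> is chosen depending on it, and the resulting bound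
  \<open>B\<close> does not depend on \<open>r\<close>. Hardy's inequality is applied to
  \<open>\<phi> n\<close> and not to the truncated function, whose jumps may make its energy
  infinite.\<close>

lemma hardy_sq_finite_if_sobolev_H0:
  assumes \<beta>: "\<beta> \<in> {0<..<2}" "\<beta> \<noteq> 1" and u: "u \<in> sobolev_H0 \<beta>"
  shows "hardy_sq \<beta> u < top"
proof -
  have uH: "u \<in> sobolev_H \<beta>" using u by (simp add: sobolev_H0_def)
  then have [measurable]: "u \<in> borel_measurable borel" by (simp add: sobolev_H_def)
  obtain \<phi> where \<phi>: "\<And>n. \<phi> n \<in> test_functions (- {0})"
    and lim: "(\<lambda>n::nat. sobolev_norm \<beta> (\<lambda>y. \<phi> n y - u y)) \<longlonglongrightarrow> 0"
    using u by (auto simp: sobolev_H0_def)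
  have \<phi>H: "\<phi> n \<in> sobolev_H \<beta>" for n using test_function_in_sobolev_H[OF \<phi> \<beta>(1)] .
  have wH: "(\<lambda>y. \<phi> n y - u y) \<in> sobolev_H \<beta>" for n
    by (intro sobolev_H_diff \<phi>H uH \<beta>)
  obtain C :: real where C: "C > 0" and hardy:
    "\<And>u. u \<in> borel_measurable borel \<Longrightarrow> hardy_sq \<beta> u < top \<Longrightarrow> hardy_sq \<beta> u \<le> ennreal C * energy \<beta> u"
    using fractional_hardy_inequality[OF \<beta>] by blast
  \<comment> \<open>The first summand is Hardy's bound for \<open>\<phi> n\<close>, whose energy is
    at most twice that of \<open>u\<close> plus twice an error of at most 1. The final 2 pays for
    the truncated error.\<close>
  define B where "B = 2 * (ennreal C * (2 * (energy \<beta> u + 1))) + 2"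
  have "hardy_sq \<beta> (\<lambda>y. u y * indicator {y. \<bar>y\<bar> \<ge> inverse (real (Suc k))} y) \<le> B" for k
  proof -
    define r where "r = inverse (real (Suc k))"
    have r: "r > 0" by (simp add: r_def)
    \<comment> \<open>The bound 1 serves the energy of the error; \<open>r powr \<beta>\<close>
      cancels the maximum \<open>r powr (- \<beta>)\<close> of the truncated weight.\<close>
    define c where "c = min 1 (r powr \<beta>)"
    have c: "c > 0" using r by (simp add: c_def)
    obtain n where n: "L2_sq (\<lambda>y. \<phi> n y - u y) \<le> ennreal c" "energy \<beta> (\<lambda>y. \<phi> n y - u y) \<le> ennreal c"
      using sobolev_norm_tendsto_0_imp_small[OF wH lim c] by blast
    have [measurable]: "\<phi> n \<in> borel_measurable borel" using \<phi>H[of n] by (simp add: sobolev_H_def)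
    let ?I = "indicator {y. \<bar>y\<bar> \<ge> r} :: real \<Rightarrow> real"
    have "hardy_sq \<beta> (\<lambda>y. u y * ?I y) = hardy_sq \<beta> (\<lambda>y. \<phi> n y * ?I y + (u y - \<phi> n y) * ?I y)"
      by (simp add: algebra_simps)
    also have "\<dots> \<le> 2 * hardy_sq \<beta> (\<lambda>y. \<phi> n y * ?I y) + 2 * hardy_sq \<beta> (\<lambda>y. (u y - \<phi> n y) * ?I y)"
      using hardy_sq_add_le[of "\<lambda>y. \<phi> n y * ?I y" "\<lambda>y. (u y - \<phi> n y) * ?I y" 1 \<beta>] by simp
    also have "hardy_sq \<beta> (\<lambda>y. \<phi> n y * ?I y) \<le> hardy_sq \<beta> (\<phi> n)"
      unfolding hardy_sq_def by (intro nn_integral_mono) (simp add: indicator_def)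
    also have "hardy_sq \<beta> (\<phi> n) \<le> ennreal C * energy \<beta> (\<phi> n)"
      using test_function_hardy_sq_finite[OF \<phi> \<beta>(1)] by (intro hardy) measurable
    also have "energy \<beta> (\<phi> n) \<le> 2 * energy \<beta> u + 2 * energy \<beta> (\<lambda>y. \<phi> n y - u y)"
      using energy_add_le[of u "\<lambda>y. \<phi> n y - u y", OF _ _ \<beta>(1)] by simp
    also have "energy \<beta> (\<lambda>y. \<phi> n y - u y) \<le> 1"
      using n(2) by (rule order_trans) (simp add: c_def)
    also have "hardy_sq \<beta> (\<lambda>y. (u y - \<phi> n y) * ?I y) \<le> ennreal (r powr (- \<beta>)) * L2_sq (\<lambda>y. (u y - \<phi> n y) * ?I y)"
      using r \<beta> by (intro hardy_sq_le_L2_sq) auto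
    also have "L2_sq (\<lambda>y. (u y - \<phi> n y) * ?I y) \<le> L2_sq (\<lambda>y. \<phi> n y - u y)"
      unfolding L2_sq_def by (intro nn_integral_mono) (simp add: indicator_def power2_commute)
    also have "\<dots> \<le> ennreal (r powr \<beta>)"
      using n(1) by (rule order_trans) (simp add: c_def ennreal_leI)
    also have "ennreal (r powr (- \<beta>)) * ennreal (r powr \<beta>) = 1"
      using r by (simp flip: ennreal_mult' powr_add)
    finally show ?thesis
      by (simp add: r_def B_def distrib_left add_mono mult_left_mono)
  qed
  then have "hardy_sq \<beta> u \<le> B"
    by (intro LIMSEQ_le_const2[OF hardy_sq_truncation_LIMSEQ]) auto
  also have "B < top"
    using uH by (simp add: B_def sobolev_H_def ennreal_mult_less_top)
  finally show ?thesis .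
qed

subsection \<open>Cutoff near zero and infinity\<close>

text \<open>The value at \<open>0\<close> is set by hand because \<open>ln 0 = 0\<close> in HOL.\<close>

definition log_cutoff :: "nat \<Rightarrow> real \<Rightarrow> real" where
  "log_cutoff n y = (if y = 0 then 0 else max 0 (min 1 (2 - \<bar>ln \<bar>y\<bar>\<bar> / (real n + 1))))"

lemma log_cutoff_measurable [measurable]: "log_cutoff n \<in> borel_measurable borel"
  unfolding log_cutoff_def[abs_def] by measurable

lemma log_cutoff_bounds: "0 \<le> log_cutoff n y" "log_cutoff n y \<le> 1"
  by (auto simp: log_cutoff_def)

lemma log_cutoff_eventually_1:
  assumes "y \<noteq> 0"
  shows "eventually (\<lambda>n. log_cutoff n y = 1) sequentially"
proof -
  obtain N :: nat where N: "\<bar>ln \<bar>y\<bar>\<bar> \<le> real N" using real_arch_simple by blast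
  have "log_cutoff n y = 1" if "n \<ge> N" for n
  proof -
    have "\<bar>ln \<bar>y\<bar>\<bar> / (real n + 1) \<le> 1"
      using N that by (simp add: divide_le_eq)
    then show ?thesis using assms by (simp add: log_cutoff_def)
  qed
  then show ?thesis by (auto simp: eventually_sequentially)
qed

lemma log_cutoff_support:
  assumes "log_cutoff n y \<noteq> 0"
  shows "exp (- 2 * (real n + 1)) \<le> \<bar>y\<bar>" "\<bar>y\<bar> \<le> exp (2 * (real n + 1))"
proof -
  have y: "y \<noteq> 0" and "\<bar>ln \<bar>y\<bar>\<bar> / (real n + 1) < 2"
    using assms by (auto simp: log_cutoff_def split: if_splits)
  then have "\<bar>ln \<bar>y\<bar>\<bar> \<le> 2 * (real n + 1)"
    by (simp add: divide_less_eq)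
  then have "- 2 * (real n + 1) \<le> ln \<bar>y\<bar>" "ln \<bar>y\<bar> \<le> 2 * (real n + 1)"
    by linarith+
  then show "exp (- 2 * (real n + 1)) \<le> \<bar>y\<bar>" "\<bar>y\<bar> \<le> exp (2 * (real n + 1))"
    using y by (metis exp_le_cancel_iff exp_ln zero_less_abs_iff)+
qed

text \<open>The bound is uniform in \<open>n\<close> and scale invariant, which makes the cutoff error in the
  energy controllable by the weight \<open>\<bar>y\<bar> powr (- \<beta>)\<close>.\<close>

lemma log_cutoff_lipschitz:
  assumes y: "y \<noteq> 0"
  shows "\<bar>log_cutoff n y' - log_cutoff n y\<bar> \<le> min 1 (2 * \<bar>y' - y\<bar> / \<bar>y\<bar>)"
proof -
  have 1: "\<bar>log_cutoff n y' - log_cutoff n y\<bar> \<le> 1"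
    using log_cutoff_bounds[of n y] log_cutoff_bounds[of n y'] by linarith
  moreover have "\<bar>log_cutoff n y' - log_cutoff n y\<bar> \<le> 2 * \<bar>y' - y\<bar> / \<bar>y\<bar>"
  proof (cases "\<bar>y'\<bar> < \<bar>y\<bar> / 2")
    \<comment> \<open>Here \<open>y'\<close> is so much closer to 0 than \<open>y\<close> that |y' -
      y| \<ge> |y| / 2, and the claimed bound is at least 1. The point \<open>y' = 0\<close> falls
      into this case.\<close>
    case True
    then have "\<bar>y\<bar> \<le> 2 * \<bar>y' - y\<bar>"
      using abs_triangle_ineq2_sym[of y y'] by simp
    then have "1 \<le> 2 * \<bar>y' - y\<bar> / \<bar>y\<bar>" using y by (simp add: le_divide_eq)
    with 1 show ?thesis by linarith
  next
    case False
    then have y': "y' \<noteq> 0" "\<bar>y\<bar> \<le> 2 * \<bar>y'\<bar>" using y by auto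
    have d: "\<bar>\<bar>y'\<bar> - \<bar>y\<bar>\<bar> \<le> \<bar>y' - y\<bar>" by (rule abs_triangle_ineq3)
    have "ln \<bar>y'\<bar> - ln \<bar>y\<bar> = ln (\<bar>y'\<bar> / \<bar>y\<bar>)"
      using y y' by (simp add: ln_div)
    also have "\<dots> \<le> \<bar>y'\<bar> / \<bar>y\<bar> - 1"
      using y y' by (intro ln_le_minus_one) simp
    also have "\<dots> = (\<bar>y'\<bar> - \<bar>y\<bar>) / \<bar>y\<bar>" using y by (simp add: field_simps)
    also have "\<dots> \<le> 2 * \<bar>y' - y\<bar> / \<bar>y\<bar>"
    proof (rule divide_right_mono)
      show "\<bar>y'\<bar> - \<bar>y\<bar> \<le> 2 * \<bar>y' - y\<bar>"
        by (rule order_trans[OF abs_triangle_ineq2]) simp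
    qed simp
    finally have a: "ln \<bar>y'\<bar> - ln \<bar>y\<bar> \<le> 2 * \<bar>y' - y\<bar> / \<bar>y\<bar>" .
    have "ln \<bar>y\<bar> - ln \<bar>y'\<bar> = ln (\<bar>y\<bar> / \<bar>y'\<bar>)"
      using y y' by (simp add: ln_div)
    also have "\<dots> \<le> \<bar>y\<bar> / \<bar>y'\<bar> - 1"
      using y y' by (intro ln_le_minus_one) simp
    also have "\<dots> = (\<bar>y\<bar> - \<bar>y'\<bar>) / \<bar>y'\<bar>" using y' by (simp add: field_simps)
    also have "\<dots> \<le> \<bar>y' - y\<bar> / \<bar>y'\<bar>" using d by (intro divide_right_mono) auto
    \<comment> \<open>The lower bound |y'| \<ge> |y| / 2 enters here and produces the factor
      2.\<close>
    also have "\<dots> \<le> \<bar>y' - y\<bar> / (\<bar>y\<bar> / 2)" using y y' by (intro divide_left_mono) auto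
    finally have b: "ln \<bar>y\<bar> - ln \<bar>y'\<bar> \<le> 2 * \<bar>y' - y\<bar> / \<bar>y\<bar>" by (simp add: field_simps)
    have c: "\<bar>\<bar>ln \<bar>y'\<bar>\<bar> - \<bar>ln \<bar>y\<bar>\<bar>\<bar> \<le> 2 * \<bar>y' - y\<bar> / \<bar>y\<bar>"
      using a b by (intro order_trans[OF abs_triangle_ineq3] abs_leI) auto
    have clamp: "\<bar>max 0 (min 1 (2 - s)) - max 0 (min 1 (2 - t))\<bar> \<le> \<bar>s - t\<bar>" for s t :: real
      by (auto simp: max_def min_def)
    have "\<bar>log_cutoff n y' - log_cutoff n y\<bar> \<le> \<bar>\<bar>ln \<bar>y'\<bar>\<bar> / (real n + 1) - \<bar>ln \<bar>y\<bar>\<bar> / (real n + 1)\<bar>"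
      using y y' clamp by (simp add: log_cutoff_def)
    also have "\<dots> = \<bar>\<bar>ln \<bar>y'\<bar>\<bar> - \<bar>ln \<bar>y\<bar>\<bar>\<bar> / (real n + 1)"
      by (simp add: diff_divide_distrib[symmetric])
    \<comment> \<open>The gain 1 / (n + 1) is given away: the estimate is meant as a majorant, and
      smallness comes from pointwise convergence.\<close>
    also have "\<dots> \<le> \<bar>\<bar>ln \<bar>y'\<bar>\<bar> - \<bar>ln \<bar>y\<bar>\<bar>\<bar> / 1"
      by (intro divide_left_mono) auto
    finally show ?thesis using c by simp
  qed
  ultimately show ?thesis by simp
qed

text \<open>Homogeneity: \<open>y' = y + y * k\<close> removes \<open>y\<close> from the minimum,
  while the Jacobian and the kernel leave |y| * |y|^(-1 - \<beta>) = |y|^(-\<beta>). This is how the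
  Hardy weight arises from the cutoffs.\<close>

lemma nn_integral_scaled_kernel_le:
  assumes \<beta>: "\<beta> \<in> {0<..<2}"
  obtains C :: ennreal where "C < top"
    "\<And>y::real. y \<noteq> 0 \<Longrightarrow> (\<integral>\<^sup>+y'. ennreal ((min 1 (2 * \<bar>y' - y\<bar> / \<bar>y\<bar>))\<^sup>2 * q_kernel \<beta> (y' - y)) \<partial>lborel)
      \<le> C * ennreal (1 / \<bar>y\<bar> powr \<beta>)"
proof -
  define I where "I = (\<integral>\<^sup>+k. ennreal (min 1 (k\<^sup>2) * \<bar>k\<bar> powr (- 1 - \<beta>)) \<partial>lborel)"
  define C where "C = ennreal (4 * q_const \<beta>) * I"
  have q: "q_const \<beta> > 0" by (rule q_const_pos[OF \<beta>])
  have "(\<integral>\<^sup>+y'. ennreal ((min 1 (2 * \<bar>y' - y\<bar> / \<bar>y\<bar>))\<^sup>2 * q_kernel \<beta> (y' - y)) \<partial>lborel) \<le> C * ennreal (1 / \<bar>y\<bar> powr \<beta>)"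
    if y: "y \<noteq> 0" for y
  proof -
    have "(\<integral>\<^sup>+y'. ennreal ((min 1 (2 * \<bar>y' - y\<bar> / \<bar>y\<bar>))\<^sup>2 * q_kernel \<beta> (y' - y)) \<partial>lborel)
      = ennreal \<bar>y\<bar> * (\<integral>\<^sup>+k. ennreal ((min 1 (2 * \<bar>(y + y * k) - y\<bar> / \<bar>y\<bar>))\<^sup>2 * q_kernel \<beta> ((y + y * k) - y)) \<partial>lborel)"
      using y by (intro nn_integral_real_affine) auto
    also have "\<dots> = (\<integral>\<^sup>+k. ennreal \<bar>y\<bar> * ennreal ((min 1 (2 * \<bar>(y + y * k) - y\<bar> / \<bar>y\<bar>))\<^sup>2 * q_kernel \<beta> ((y + y * k) - y)) \<partial>lborel)"
      by (intro nn_integral_cmult[symmetric]) measurable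
    also have "\<dots> \<le> (\<integral>\<^sup>+k. ennreal (4 * q_const \<beta> / \<bar>y\<bar> powr \<beta>) * ennreal (min 1 (k\<^sup>2) * \<bar>k\<bar> powr (- 1 - \<beta>)) \<partial>lborel)"
    proof (rule nn_integral_mono)
      fix k :: real
      have min: "(min 1 (2 * \<bar>k\<bar>))\<^sup>2 \<le> 4 * min 1 (k\<^sup>2)"
      proof (cases "\<bar>k\<bar> \<le> 1")
        case True
        then have "k\<^sup>2 \<le> 1" by (simp add: abs_square_le_1)
        have "(min 1 (2 * \<bar>k\<bar>))\<^sup>2 \<le> (2 * \<bar>k\<bar>)\<^sup>2" by (intro power_mono) auto
        with \<open>k\<^sup>2 \<le> 1\<close> show ?thesis by (simp add: power_mult_distrib)
      next
        case False
        then have "k\<^sup>2 > 1" by (simp add: abs_square_le_1 flip: not_le)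
        have "(min 1 (2 * \<bar>k\<bar>))\<^sup>2 \<le> 1\<^sup>2" by (intro power_mono) auto
        with \<open>k\<^sup>2 > 1\<close> show ?thesis by simp
      qed
      have "\<bar>y\<bar> * ((min 1 (2 * \<bar>k\<bar>))\<^sup>2 * (q_const \<beta> * (\<bar>y\<bar> powr (- 1 - \<beta>) * \<bar>k\<bar> powr (- 1 - \<beta>))))
        = (min 1 (2 * \<bar>k\<bar>))\<^sup>2 * (q_const \<beta> * (\<bar>y\<bar> powr (- \<beta>) * \<bar>k\<bar> powr (- 1 - \<beta>)))"
        using y powr_add[of "\<bar>y\<bar>" 1 "- 1 - \<beta>"] by simp
      also have "\<dots> \<le> (4 * min 1 (k\<^sup>2)) * (q_const \<beta> * (\<bar>y\<bar> powr (- \<beta>) * \<bar>k\<bar> powr (- 1 - \<beta>)))"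
        using q by (intro mult_right_mono min) auto
      also have "\<dots> = 4 * q_const \<beta> / \<bar>y\<bar> powr \<beta> * (min 1 (k\<^sup>2) * \<bar>k\<bar> powr (- 1 - \<beta>))"
        by (simp add: powr_minus field_simps)
      finally have "\<bar>y\<bar> * ((min 1 (2 * \<bar>k\<bar>))\<^sup>2 * (q_const \<beta> * (\<bar>y\<bar> powr (- 1 - \<beta>) * \<bar>k\<bar> powr (- 1 - \<beta>))))
        \<le> 4 * q_const \<beta> / \<bar>y\<bar> powr \<beta> * (min 1 (k\<^sup>2) * \<bar>k\<bar> powr (- 1 - \<beta>))" .
      then show "ennreal \<bar>y\<bar> * ennreal ((min 1 (2 * \<bar>(y + y * k) - y\<bar> / \<bar>y\<bar>))\<^sup>2 * q_kernel \<beta> ((y + y * k) - y))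
        \<le> ennreal (4 * q_const \<beta> / \<bar>y\<bar> powr \<beta>) * ennreal (min 1 (k\<^sup>2) * \<bar>k\<bar> powr (- 1 - \<beta>))"
        using y q by (subst (1 2) ennreal_mult'[symmetric])
          (auto simp: q_kernel_def abs_mult powr_mult intro!: ennreal_leI)
    qed
    also have "\<dots> = ennreal (4 * q_const \<beta> / \<bar>y\<bar> powr \<beta>) * I"
      unfolding I_def by (rule nn_integral_cmult) measurable
    also have "ennreal (4 * q_const \<beta> / \<bar>y\<bar> powr \<beta>) = ennreal (4 * q_const \<beta>) * ennreal (1 / \<bar>y\<bar> powr \<beta>)"
      using q by (subst ennreal_mult'[symmetric]) auto
    finally show ?thesis by (simp add: C_def mult_ac)
  qed
  moreover have "C < top"
    using nn_integral_min_powr_finite[OF \<beta>] by (simp add: C_def I_def ennreal_mult_less_top)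
  ultimately show thesis using that by blast
qed

text \<open>The axes have to be discarded: \<open>log_cutoff n 0\<close> is 0 for every
  \<open>n\<close>, so there is no convergence to 1 there, and the Lipschitz bound divides by
  |y|.\<close>

lemma AE_pair_lborel_nonzero: "AE (y, y') in lborel \<Otimes>\<^sub>M lborel. y \<noteq> (0::real) \<and> y' \<noteq> (0::real)"
proof (rule lborel_pair.AE_pair_measure)
  have "AE y in lborel. AE y' in lborel. y \<noteq> (0::real) \<and> y' \<noteq> (0::real)"
    using AE_lborel_singleton[of "0::real"] by eventually_elim (auto intro: AE_lborel_singleton)
  then show "AE y in lborel. AE y' in lborel. case (y, y') of (y, y') \<Rightarrow> y \<noteq> (0::real) \<and> y' \<noteq> (0::real)"
    by simp
qed measurable

text \<open>Pointwise convergence is immediate, since away from 0 the error is eventually equal to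
  0. The work lies in the integrable majorants.\<close>

lemma log_cutoff_error_tendsto_0:
  assumes \<beta>: "\<beta> \<in> {0<..<2}" and u: "u \<in> sobolev_H \<beta>" and fin: "hardy_sq \<beta> u < top"
  shows "(\<lambda>n. L2_sq (\<lambda>y. u y * log_cutoff n y - u y)) \<longlonglongrightarrow> 0"
    and "(\<lambda>n. energy \<beta> (\<lambda>y. u y * log_cutoff n y - u y)) \<longlonglongrightarrow> 0"
proof -
  have [measurable]: "u \<in> borel_measurable borel" and uL: "L2_sq u < top" and uE: "energy \<beta> u < top"
    using u by (auto simp: sobolev_H_def)
  let ?w = "\<lambda>n y. u y * log_cutoff n y - u y"
  have w0: "eventually (\<lambda>n. ?w n y = 0) sequentially" if "y \<noteq> 0" for y
    using log_cutoff_eventually_1[OF that] by eventually_elim simp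
  have c1: "(log_cutoff n y - 1)\<^sup>2 \<le> 1" for n y
    using log_cutoff_bounds[of n y] by (simp add: abs_square_le_1)
  have "(\<lambda>n. \<integral>\<^sup>+y. ennreal ((?w n y)\<^sup>2) \<partial>lborel) \<longlonglongrightarrow> (\<integral>\<^sup>+y. 0 \<partial>(lborel :: real measure))"
  proof (rule nn_integral_dominated_convergence)
    show "AE y in lborel. ennreal ((?w n y)\<^sup>2) \<le> ennreal ((u y)\<^sup>2)" for n
    proof (intro AE_I2 ennreal_leI)
      fix y
      have "(?w n y)\<^sup>2 = (u y)\<^sup>2 * (log_cutoff n y - 1)\<^sup>2"
        by (simp add: power_mult_distrib[symmetric] algebra_simps)
      also have "\<dots> \<le> (u y)\<^sup>2 * 1" by (intro mult_left_mono c1) simp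
      finally show "(?w n y)\<^sup>2 \<le> (u y)\<^sup>2" by simp
    qed
    show "AE y in lborel. (\<lambda>n. ennreal ((?w n y)\<^sup>2)) \<longlonglongrightarrow> 0"
      using AE_lborel_singleton[of "0::real"]
    proof eventually_elim
      fix y :: real assume "y \<noteq> 0"
      from w0[OF this] show "(\<lambda>n. ennreal ((?w n y)\<^sup>2)) \<longlonglongrightarrow> 0"
        by (intro tendsto_eventually) (auto elim: eventually_mono)
    qed
    show "(\<integral>\<^sup>+y. ennreal ((u y)\<^sup>2) \<partial>lborel) < \<infinity>" using uL by (simp add: L2_sq_def)
  qed measurable
  then show "(\<lambda>n. L2_sq (?w n)) \<longlonglongrightarrow> 0" by (simp add: L2_sq_def)

  let ?F = "\<lambda>n (y, y'). ennreal ((?w n y' - ?w n y)\<^sup>2 * q_kernel \<beta> (y' - y))"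
  let ?G1 = "\<lambda>(y, y'). ennreal ((u y' - u y)\<^sup>2 * q_kernel \<beta> (y' - y))"
  let ?G2 = "\<lambda>(y, y'). ennreal ((u y)\<^sup>2) * ennreal ((min 1 (2 * \<bar>y' - y\<bar> / \<bar>y\<bar>))\<^sup>2 * q_kernel \<beta> (y' - y))"
  have "(\<lambda>n. \<integral>\<^sup>+z. ?F n z \<partial>(lborel \<Otimes>\<^sub>M lborel)) \<longlonglongrightarrow> (\<integral>\<^sup>+z. 0 \<partial>(lborel \<Otimes>\<^sub>M lborel :: (real \<times> real) measure))"
  proof (rule nn_integral_dominated_convergence[where w = "\<lambda>z. 2 * ?G1 z + 2 * ?G2 z"])
    show "AE z in lborel \<Otimes>\<^sub>M lborel. ?F n z \<le> 2 * ?G1 z + 2 * ?G2 z" for n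
      using AE_pair_lborel_nonzero
    proof eventually_elim
      fix z :: "real \<times> real" assume "case z of (y, y') \<Rightarrow> y \<noteq> 0 \<and> y' \<noteq> 0"
      then obtain y y' where z: "z = (y, y')" and y: "y \<noteq> 0" by (cases z) auto
      let ?d = "log_cutoff n y' - log_cutoff n y" and ?m = "min 1 (2 * \<bar>y' - y\<bar> / \<bar>y\<bar>)"
      have d: "?d\<^sup>2 \<le> ?m\<^sup>2"
        using log_cutoff_lipschitz[OF y, of n y'] by (metis abs_ge_zero power2_abs power_mono)
      \<comment> \<open>Discrete product rule for \<open>u\<close> times the cutoff minus 1. It is
        arranged so that the increment of \<open>u\<close> carries a factor of modulus at most 1 and
        the increment of the cutoff carries \<open>u y\<close>, at the same point whose modulus
        normalises the Lipschitz bound.\<close>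
      have "(?w n y' - ?w n y)\<^sup>2 = ((log_cutoff n y' - 1) * (u y' - u y) + u y * ?d)\<^sup>2"
        by (simp add: algebra_simps)
      also have "\<dots> \<le> 2 * ((log_cutoff n y' - 1) * (u y' - u y))\<^sup>2 + 2 * (u y * ?d)\<^sup>2"
        using square_add_le_weighted[of 1 "(log_cutoff n y' - 1) * (u y' - u y)" "u y * ?d"] by simp
      also have "\<dots> = 2 * ((log_cutoff n y' - 1)\<^sup>2 * (u y' - u y)\<^sup>2) + 2 * ((u y)\<^sup>2 * ?d\<^sup>2)"
        by (simp add: power_mult_distrib)
      also have "\<dots> \<le> 2 * (1 * (u y' - u y)\<^sup>2) + 2 * ((u y)\<^sup>2 * ?m\<^sup>2)"
        by (intro add_mono mult_left_mono mult_right_mono c1 d) auto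
      finally have "(?w n y' - ?w n y)\<^sup>2 * q_kernel \<beta> (y' - y)
          \<le> (2 * (1 * (u y' - u y)\<^sup>2) + 2 * ((u y)\<^sup>2 * ?m\<^sup>2)) * q_kernel \<beta> (y' - y)"
        by (intro mult_right_mono q_kernel_nonneg \<beta>)
      also have "\<dots> = 2 * ((u y' - u y)\<^sup>2 * q_kernel \<beta> (y' - y)) + 2 * ((u y)\<^sup>2 * (?m\<^sup>2 * q_kernel \<beta> (y' - y)))"
        by (simp add: algebra_simps)
      finally have "ennreal ((?w n y' - ?w n y)\<^sup>2 * q_kernel \<beta> (y' - y))
        \<le> ennreal (2 * ((u y' - u y)\<^sup>2 * q_kernel \<beta> (y' - y)) + 2 * ((u y)\<^sup>2 * (?m\<^sup>2 * q_kernel \<beta> (y' - y))))"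
        by (rule ennreal_leI)
      also have "\<dots> = 2 * ennreal ((u y' - u y)\<^sup>2 * q_kernel \<beta> (y' - y))
          + 2 * (ennreal ((u y)\<^sup>2) * ennreal (?m\<^sup>2 * q_kernel \<beta> (y' - y)))"
        using q_kernel_nonneg[OF \<beta>] by (simp add: ennreal_plus ennreal_mult')
      finally show "?F n z \<le> 2 * ?G1 z + 2 * ?G2 z"
        by (simp add: z)
    qed
    show "AE z in lborel \<Otimes>\<^sub>M lborel. (\<lambda>n. ?F n z) \<longlonglongrightarrow> 0"
      using AE_pair_lborel_nonzero
    proof eventually_elim
      fix z :: "real \<times> real" assume "case z of (y, y') \<Rightarrow> y \<noteq> 0 \<and> y' \<noteq> 0"
      then obtain y y' where z: "z = (y, y')" and y: "y \<noteq> 0" "y' \<noteq> 0" by (cases z) auto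
      have "eventually (\<lambda>n. ?F n z = 0) sequentially"
        using w0[OF y(1)] w0[OF y(2)] by eventually_elim (auto simp: z)
      then show "(\<lambda>n. ?F n z) \<longlonglongrightarrow> 0" by (rule tendsto_eventually)
    qed
    obtain C :: ennreal where C: "C < top"
      "\<And>y::real. y \<noteq> 0 \<Longrightarrow> (\<integral>\<^sup>+y'. ennreal ((min 1 (2 * \<bar>y' - y\<bar> / \<bar>y\<bar>))\<^sup>2 * q_kernel \<beta> (y' - y)) \<partial>lborel)
        \<le> C * ennreal (1 / \<bar>y\<bar> powr \<beta>)"
      using nn_integral_scaled_kernel_le[OF \<beta>] by blast
    have "(\<integral>\<^sup>+z. ?G2 z \<partial>(lborel \<Otimes>\<^sub>M lborel))
      = (\<integral>\<^sup>+y. \<integral>\<^sup>+y'. ennreal ((u y)\<^sup>2) * ennreal ((min 1 (2 * \<bar>y' - y\<bar> / \<bar>y\<bar>))\<^sup>2 * q_kernel \<beta> (y' - y)) \<partial>lborel \<partial>lborel)"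
      by (subst lborel.nn_integral_fst[symmetric]) auto
    also have "\<dots> = (\<integral>\<^sup>+y. ennreal ((u y)\<^sup>2) * (\<integral>\<^sup>+y'. ennreal ((min 1 (2 * \<bar>y' - y\<bar> / \<bar>y\<bar>))\<^sup>2 * q_kernel \<beta> (y' - y)) \<partial>lborel) \<partial>lborel)"
      by (intro nn_integral_cong nn_integral_cmult) measurable
    also have "\<dots> \<le> (\<integral>\<^sup>+y. C * ennreal ((u y)\<^sup>2 / \<bar>y\<bar> powr \<beta>) \<partial>lborel)"
    proof (rule nn_integral_mono_AE)
      show "AE y in lborel. ennreal ((u y)\<^sup>2) * (\<integral>\<^sup>+y'. ennreal ((min 1 (2 * \<bar>y' - y\<bar> / \<bar>y\<bar>))\<^sup>2 * q_kernel \<beta> (y' - y)) \<partial>lborel)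
        \<le> C * ennreal ((u y)\<^sup>2 / \<bar>y\<bar> powr \<beta>)"
        using AE_lborel_singleton[of "0::real"]
      proof eventually_elim
        fix y :: real assume "y \<noteq> 0"
        have "ennreal ((u y)\<^sup>2) * (\<integral>\<^sup>+y'. ennreal ((min 1 (2 * \<bar>y' - y\<bar> / \<bar>y\<bar>))\<^sup>2 * q_kernel \<beta> (y' - y)) \<partial>lborel)
          \<le> ennreal ((u y)\<^sup>2) * (C * ennreal (1 / \<bar>y\<bar> powr \<beta>))"
          by (intro mult_left_mono C(2) \<open>y \<noteq> 0\<close>) simp
        also have "\<dots> = C * (ennreal ((u y)\<^sup>2) * ennreal (1 / \<bar>y\<bar> powr \<beta>))"
          by (simp add: mult_ac)
        also have "ennreal ((u y)\<^sup>2) * ennreal (1 / \<bar>y\<bar> powr \<beta>) = ennreal ((u y)\<^sup>2 / \<bar>y\<bar> powr \<beta>)"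
          by (subst ennreal_mult'[symmetric]) auto
        finally show "ennreal ((u y)\<^sup>2) * (\<integral>\<^sup>+y'. ennreal ((min 1 (2 * \<bar>y' - y\<bar> / \<bar>y\<bar>))\<^sup>2 * q_kernel \<beta> (y' - y)) \<partial>lborel)
          \<le> C * ennreal ((u y)\<^sup>2 / \<bar>y\<bar> powr \<beta>)" .
      qed
    qed
    also have "\<dots> = C * hardy_sq \<beta> u"
      unfolding hardy_sq_def by (rule nn_integral_cmult) measurable
    finally have G2: "(\<integral>\<^sup>+z. ?G2 z \<partial>(lborel \<Otimes>\<^sub>M lborel)) < top"
      by (rule le_less_trans) (use C(1) fin in \<open>simp add: ennreal_mult_less_top\<close>)
    have G1: "(\<integral>\<^sup>+z. ?G1 z \<partial>(lborel \<Otimes>\<^sub>M lborel)) < top"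
      using uE by (simp only: energy_def ennreal_half_less_top_iff)
    have "(\<integral>\<^sup>+z. 2 * ?G1 z + 2 * ?G2 z \<partial>(lborel \<Otimes>\<^sub>M lborel))
        = 2 * (\<integral>\<^sup>+z. ?G1 z \<partial>(lborel \<Otimes>\<^sub>M lborel)) + 2 * (\<integral>\<^sup>+z. ?G2 z \<partial>(lborel \<Otimes>\<^sub>M lborel))"
      by (subst nn_integral_add) (auto simp: nn_integral_cmult)
    also have "\<dots> < top" using G1 G2 by (simp add: ennreal_mult_less_top)
    finally show "(\<integral>\<^sup>+z. 2 * ?G1 z + 2 * ?G2 z \<partial>(lborel \<Otimes>\<^sub>M lborel)) < \<infinity>" by simp
  qed measurable
  then have "(\<lambda>n. \<integral>\<^sup>+z. ?F n z \<partial>(lborel \<Otimes>\<^sub>M lborel)) \<longlonglongrightarrow> 0" by simp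
  then have "(\<lambda>n. (1 / 2) * (\<integral>\<^sup>+z. ?F n z \<partial>(lborel \<Otimes>\<^sub>M lborel))) \<longlonglongrightarrow> (1 / 2) * 0"
    by (intro ennreal_tendsto_cmult) (use ennreal_half_less_top_iff[of 1] in simp_all)
  then show "(\<lambda>n. energy \<beta> (?w n)) \<longlonglongrightarrow> 0" by (simp add: energy_def)
qed

subsection \<open>Continuity of translations\<close>

lemma ennreal_tendsto_0_iff:
  fixes x :: "'a \<Rightarrow> ennreal"
  shows "(x \<longlongrightarrow> 0) F \<longleftrightarrow> (\<forall>e::real. e > 0 \<longrightarrow> eventually (\<lambda>n. x n \<le> ennreal e) F)"
proof
  assume *: "(x \<longlongrightarrow> 0) F"
  show "\<forall>e::real. e > 0 \<longrightarrow> eventually (\<lambda>n. x n \<le> ennreal e) F"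
  proof (intro allI impI)
    fix e :: real assume "e > 0"
    then show "eventually (\<lambda>n. x n \<le> ennreal e) F"
      using order_tendstoD(2)[OF *, of "ennreal e"] by (auto elim: eventually_mono)
  qed
next
  assume *: "\<forall>e::real. e > 0 \<longrightarrow> eventually (\<lambda>n. x n \<le> ennreal e) F"
  show "(x \<longlongrightarrow> 0) F"
  proof (rule order_tendstoI)
    fix a :: ennreal assume "0 < a"
    then obtain b where b: "0 < b" "b < a" using dense by blast
    then obtain e where e: "b = ennreal e" "e > 0"
      by (cases b rule: ennreal_cases) (auto simp: ennreal_less_zero_iff)
    from *[rule_format, OF e(2)] show "eventually (\<lambda>n. x n < a) F"
      by eventually_elim (use b e in auto)
  qed simp
qed

text \<open>For open sets, continuity of translations is dominated convergence; outer regularity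
  extends it to all measurable sets of finite measure.\<close>

lemma nn_integral_open_leaves_tendsto_0:
  fixes U :: "real set"
  assumes U: "open U" and fin: "emeasure lborel U < top" and s: "s \<longlonglongrightarrow> 0"
  shows "(\<lambda>n. \<integral>\<^sup>+x. indicator U x * indicator (- U) (x + s n) \<partial>lborel) \<longlonglongrightarrow> 0"
proof -
  have [measurable]: "U \<in> sets borel" using U by simp
  have "(\<lambda>n. \<integral>\<^sup>+x. indicator U x * indicator (- U) (x + s n) \<partial>lborel) \<longlonglongrightarrow> (\<integral>\<^sup>+x. 0 \<partial>(lborel :: real measure))"
  proof (rule nn_integral_dominated_convergence[where w = "indicator U"])
    show "AE x in lborel. (\<lambda>n. indicator U x * indicator (- U) (x + s n) :: ennreal) \<longlonglongrightarrow> 0"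
    proof (rule AE_I2)
      fix x
      show "(\<lambda>n. indicator U x * indicator (- U) (x + s n) :: ennreal) \<longlonglongrightarrow> 0"
      proof (cases "x \<in> U")
        case True
        have "(\<lambda>n. x + s n) \<longlonglongrightarrow> x" using tendsto_add[OF tendsto_const s] by simp
        then have "eventually (\<lambda>n. x + s n \<in> U) sequentially"
          using U True by (rule topological_tendstoD)
        then have "eventually (\<lambda>n. indicator U x * indicator (- U) (x + s n) = (0::ennreal)) sequentially"
          by eventually_elim simp
        then show ?thesis
          by (rule tendsto_eventually)
      qed simp
    qed
    show "AE x in lborel. indicator U x * indicator (- U) (x + s n) \<le> (indicator U x :: ennreal)" for n
      by (intro AE_I2) (auto simp: indicator_def)
  qed (use fin in auto)
  then show ?thesis by simp
qed

section \<open>Translations in L1\<close>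

definition L1_dist :: "(real \<Rightarrow> real) \<Rightarrow> (real \<Rightarrow> real) \<Rightarrow> ennreal" where
  "L1_dist f g = (\<integral>\<^sup>+x. ennreal \<bar>f x - g x\<bar> \<partial>lborel)"

lemma L1_dist_triangle:
  assumes [measurable]: "f \<in> borel_measurable borel" "g \<in> borel_measurable borel" "h \<in> borel_measurable borel"
  shows "L1_dist f h \<le> L1_dist f g + L1_dist g h"
proof -
  have "L1_dist f h \<le> (\<integral>\<^sup>+x. ennreal \<bar>f x - g x\<bar> + ennreal \<bar>g x - h x\<bar> \<partial>lborel)"
    unfolding L1_dist_def
    by (intro nn_integral_mono) (simp add: ennreal_leI flip: ennreal_plus)
  then show ?thesis
    unfolding L1_dist_def by (simp add: nn_integral_add)
qed

lemma L1_dist_commute: "L1_dist f g = L1_dist g f"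
  by (simp add: L1_dist_def abs_minus_commute)

lemma L1_dist_shift:
  assumes [measurable]: "f \<in> borel_measurable borel" "g \<in> borel_measurable borel"
  shows "L1_dist (\<lambda>x. f (x + s)) (\<lambda>x. g (x + s)) = L1_dist f g"
  unfolding L1_dist_def by (rule nn_integral_lborel_shift) measurable

text \<open>Translations are isometries of L1, so the functions on which they act continuously form
  a closed set; this is the usual argument with three times e / 3. It is used to pass from open to
  measurable sets and from approximants to integrable functions.\<close>

lemma L1_shift_tendsto_0_closure:
  assumes [measurable]: "f \<in> borel_measurable borel"
    and approx: "\<And>e::real. e > 0 \<Longrightarrow> \<exists>g \<in> borel_measurable borel. L1_dist f g \<le> ennreal e \<and>
      (\<lambda>n. L1_dist (\<lambda>x. g (x + s n)) g) \<longlonglongrightarrow> 0"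
  shows "(\<lambda>n. L1_dist (\<lambda>x. f (x + s n)) f) \<longlonglongrightarrow> 0"
  unfolding ennreal_tendsto_0_iff
proof (intro allI impI)
  fix e :: real assume "e > 0"
  then obtain g where [measurable]: "g \<in> borel_measurable borel" and g: "L1_dist f g \<le> ennreal (e / 3)"
    "(\<lambda>n. L1_dist (\<lambda>x. g (x + s n)) g) \<longlonglongrightarrow> 0"
    using approx[of "e / 3"] by auto
  have "eventually (\<lambda>n. L1_dist (\<lambda>x. g (x + s n)) g \<le> ennreal (e / 3)) sequentially"
    using g(2) \<open>e > 0\<close> by (simp add: ennreal_tendsto_0_iff)
  then show "eventually (\<lambda>n. L1_dist (\<lambda>x. f (x + s n)) f \<le> ennreal e) sequentially"
  proof eventually_elim
    fix n assume n: "L1_dist (\<lambda>x. g (x + s n)) g \<le> ennreal (e / 3)"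
    have "L1_dist (\<lambda>x. f (x + s n)) f \<le> L1_dist (\<lambda>x. f (x + s n)) (\<lambda>x. g (x + s n)) + L1_dist (\<lambda>x. g (x + s n)) f"
      by (rule L1_dist_triangle) measurable
    also have "L1_dist (\<lambda>x. g (x + s n)) f \<le> L1_dist (\<lambda>x. g (x + s n)) g + L1_dist g f"
      by (rule L1_dist_triangle) measurable
    also have "L1_dist (\<lambda>x. f (x + s n)) (\<lambda>x. g (x + s n)) = L1_dist f g"
      by (rule L1_dist_shift) measurable
    also have "L1_dist f g + (L1_dist (\<lambda>x. g (x + s n)) g + L1_dist g f)
        \<le> ennreal (e / 3) + (ennreal (e / 3) + ennreal (e / 3))"
      using g(1) by (intro add_mono n) (simp_all add: L1_dist_commute[of g f])
    also have "\<dots> = ennreal e"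
      using \<open>e > 0\<close> by (simp flip: ennreal_plus)
    finally show "L1_dist (\<lambda>x. f (x + s n)) f \<le> ennreal e"
      by (simp add: add_left_mono)
  qed
qed

text \<open>The symmetric difference of \<open>U\<close> and its translate consists of points
  leaving \<open>U\<close> under the shift by \<open>t\<close> and points leaving it under the shift
  by \<open>- t\<close>, the latter displaced by \<open>t\<close>. Translation invariance removes
  the displacement.\<close>

lemma L1_shift_indicator_open:
  fixes U :: "real set"
  assumes U: "open U" and fin: "emeasure lborel U < top" and s: "s \<longlonglongrightarrow> 0"
  shows "(\<lambda>n. L1_dist (\<lambda>x. indicator U (x + s n)) (indicator U)) \<longlonglongrightarrow> 0"
proof -
  have [measurable]: "U \<in> sets borel" using U by simp
  let ?J = "\<lambda>t. \<integral>\<^sup>+x. indicator U x * indicator (- U) (x + t) \<partial>lborel"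
  have "L1_dist (\<lambda>x. indicator U (x + t)) (indicator U) = ?J t + ?J (- t)" for t
  proof -
    have "ennreal \<bar>indicator U (x + t) - indicator U x\<bar>
       = indicator U x * indicator (- U) (x + t) + indicator U (x + t) * indicator (- U) (x + t + - t)" for x
      by (auto simp: indicator_def)
    then have "L1_dist (\<lambda>x. indicator U (x + t)) (indicator U)
      = ?J t + (\<integral>\<^sup>+x. indicator U (x + t) * indicator (- U) (x + t + - t) \<partial>lborel)"
      unfolding L1_dist_def by (simp only:) (rule nn_integral_add; measurable)
    also have "(\<integral>\<^sup>+x. indicator U (x + t) * indicator (- U) (x + t + - t) \<partial>lborel) = ?J (- t)"
      by (rule nn_integral_lborel_shift) measurable
    finally show ?thesis .
  qed
  moreover have "(\<lambda>n. - s n) \<longlonglongrightarrow> 0" using tendsto_minus[OF s] by simp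
  ultimately show ?thesis
    using tendsto_add[OF nn_integral_open_leaves_tendsto_0[OF U fin s]
      nn_integral_open_leaves_tendsto_0[OF U fin, of "\<lambda>n. - s n"]] by simp
qed

lemma L1_shift_indicator:
  assumes A: "A \<in> sets lborel" and fin: "emeasure lborel A < top" and s: "s \<longlonglongrightarrow> (0::real)"
  shows "(\<lambda>n. L1_dist (\<lambda>x. indicator A (x + s n)) (indicator A)) \<longlonglongrightarrow> 0"
proof (rule L1_shift_tendsto_0_closure)
  have [measurable]: "A \<in> sets borel" using A by simp
  then show "indicator A \<in> borel_measurable borel" by measurable
  fix e :: real assume "e > 0"
  then obtain U where U: "open U" "A \<subseteq> U" "emeasure lborel (U - A) < ennreal e"
    using outer_regular_lborel[of A e] by auto
  have [measurable]: "U \<in> sets borel" using U by simp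
  have "emeasure lborel U = emeasure lborel (A \<union> (U - A))"
    using U(2) by (simp add: Un_absorb1)
  also have "\<dots> \<le> emeasure lborel A + emeasure lborel (U - A)"
    by (intro emeasure_subadditive) auto
  also have "\<dots> < top"
    using fin U(3) by (auto intro: less_trans)
  finally have "(\<lambda>n. L1_dist (\<lambda>x. indicator U (x + s n)) (indicator U)) \<longlonglongrightarrow> 0"
    using U(1) s by (intro L1_shift_indicator_open)
  moreover have "L1_dist (indicator A) (indicator U) = (\<integral>\<^sup>+x. indicator (U - A) x \<partial>lborel)"
    unfolding L1_dist_def using U(2) by (intro nn_integral_cong) (auto simp: indicator_def)
  then have "L1_dist (indicator A) (indicator U) \<le> ennreal e"
    using U(3) by simp
  ultimately show "\<exists>g \<in> borel_measurable borel. L1_dist (indicator A) g \<le> ennreal e \<and>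
      (\<lambda>n. L1_dist (\<lambda>x. g (x + s n)) g) \<longlonglongrightarrow> 0"
    by (intro bexI[of _ "indicator U"]) auto
qed

theorem L1_shift_tendsto_0:
  assumes f: "integrable lborel f" and s: "s \<longlonglongrightarrow> 0"
  shows "(\<lambda>n. L1_dist (\<lambda>x. f (x + s n)) f) \<longlonglongrightarrow> 0"
  using f
proof (induction rule: integrable_induct)
  case (base A c)
  have "L1_dist (\<lambda>x. indicator A (x + s n) *\<^sub>R c) (\<lambda>x. indicator A x *\<^sub>R c)
      = ennreal \<bar>c\<bar> * L1_dist (\<lambda>x. indicator A (x + s n)) (indicator A)" for n
  proof -
    have [measurable]: "A \<in> sets borel" using base by simp
    have "\<bar>indicator A (x + s n) *\<^sub>R c - indicator A x *\<^sub>R c\<bar> = \<bar>c\<bar> * \<bar>indicator A (x + s n) - indicator A x\<bar>" for x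
      by (auto simp: indicator_def)
    then show ?thesis
      unfolding L1_dist_def by (simp only: ennreal_mult' abs_ge_zero) (rule nn_integral_cmult; measurable)
  qed
  moreover have "(\<lambda>n. ennreal \<bar>c\<bar> * L1_dist (\<lambda>x. indicator A (x + s n)) (indicator A)) \<longlonglongrightarrow> ennreal \<bar>c\<bar> * 0"
    using base s by (intro ennreal_tendsto_cmult L1_shift_indicator) auto
  ultimately show ?case by simp
next
  case (add f g)
  have [measurable]: "f \<in> borel_measurable borel" "g \<in> borel_measurable borel"
    using add by (auto dest: borel_measurable_integrable)
  have le: "L1_dist (\<lambda>x. f (x + s n) + g (x + s n)) (\<lambda>x. f x + g x)
    \<le> L1_dist (\<lambda>x. f (x + s n)) f + L1_dist (\<lambda>x. g (x + s n)) g" for n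
  proof -
    have "L1_dist (\<lambda>x. f (x + s n) + g (x + s n)) (\<lambda>x. f x + g x)
      \<le> (\<integral>\<^sup>+x. ennreal \<bar>f (x + s n) - f x\<bar> + ennreal \<bar>g (x + s n) - g x\<bar> \<partial>lborel)"
      unfolding L1_dist_def
      by (intro nn_integral_mono) (simp add: ennreal_leI flip: ennreal_plus)
    then show ?thesis
      unfolding L1_dist_def by (simp add: nn_integral_add)
  qed
  have lim: "(\<lambda>n. L1_dist (\<lambda>x. f (x + s n)) f + L1_dist (\<lambda>x. g (x + s n)) g) \<longlonglongrightarrow> 0"
    using tendsto_add[OF add.IH(1,2)] by simp
  show ?case
    by (rule tendsto_sandwich[OF _ _ tendsto_const lim]) (auto simp: le)
next
  case (lim f g)
  have [measurable]: "f \<in> borel_measurable borel" "g i \<in> borel_measurable borel" for i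
    using lim by (auto dest: borel_measurable_integrable)
  have conv: "(\<lambda>i. \<integral>\<^sup>+x. ennreal \<bar>f x - g i x\<bar> \<partial>lborel) \<longlonglongrightarrow> (\<integral>\<^sup>+x. 0 \<partial>(lborel :: real measure))"
  proof (rule nn_integral_dominated_convergence[where w = "\<lambda>x. ennreal (3 * \<bar>f x\<bar>)"])
    show "AE x in lborel. ennreal \<bar>f x - g i x\<bar> \<le> ennreal (3 * \<bar>f x\<bar>)" for i
    proof (intro AE_I2 ennreal_leI)
      \<comment> \<open>The induction principle supplies approximants with |g i x| \<le> 2 |f x|,
        whence the factor 3.\<close>
      fix x show "\<bar>f x - g i x\<bar> \<le> 3 * \<bar>f x\<bar>"
        using lim.hyps(3)[of x i] by (simp add: abs_if split: if_splits)
    qed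
    show "AE x in lborel. (\<lambda>i. ennreal \<bar>f x - g i x\<bar>) \<longlonglongrightarrow> 0"
    proof (rule AE_I2)
      fix x
      have "(\<lambda>i. \<bar>f x - g i x\<bar>) \<longlonglongrightarrow> \<bar>f x - f x\<bar>"
        by (intro tendsto_intros lim.hyps(2)) simp
      then have "(\<lambda>i. ennreal \<bar>f x - g i x\<bar>) \<longlonglongrightarrow> ennreal 0"
        by (intro tendsto_ennrealI) simp
      then show "(\<lambda>i. ennreal \<bar>f x - g i x\<bar>) \<longlonglongrightarrow> 0" by simp
    qed
    have "integrable lborel (\<lambda>x. 3 * \<bar>f x\<bar>)" using lim.hyps(4) by simp
    then show "(\<integral>\<^sup>+x. ennreal (3 * \<bar>f x\<bar>) \<partial>lborel) < \<infinity>"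
      unfolding integrable_iff_bounded by (auto simp: abs_mult)
  qed measurable
  show ?case
  proof (rule L1_shift_tendsto_0_closure)
    fix e :: real assume "e > 0"
    with conv have "eventually (\<lambda>i. L1_dist f (g i) \<le> ennreal e) sequentially"
      by (simp add: ennreal_tendsto_0_iff L1_dist_def)
    then obtain i where "L1_dist f (g i) \<le> ennreal e"
      by (auto dest: eventually_happens)
    then show "\<exists>g \<in> borel_measurable borel. L1_dist f g \<le> ennreal e \<and>
      (\<lambda>n. L1_dist (\<lambda>x. g (x + s n)) g) \<longlonglongrightarrow> 0"
      using lim.IH by (intro bexI[of _ "g i"]) auto
  qed measurable
qed

text \<open>For nonnegative functions the \<open>L\<^sup>2\<close> statement reduces to the \<open>L\<^sup>1\<close> statement for the square,
  since \<open>(a - b)\<^sup>2 \<le> \<bar>a\<^sup>2 - b\<^sup>2\<bar>\<close> when \<open>a, b \<ge> 0\<close>.\<close>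

lemma L2_shift_tendsto_0_nonneg:
  assumes [measurable]: "p \<in> borel_measurable borel" and nn: "\<And>x. p x \<ge> 0"
    and fin: "L2_sq p < top" and s: "s \<longlonglongrightarrow> 0"
  shows "(\<lambda>n. L2_sq (\<lambda>x. p (x + s n) - p x)) \<longlonglongrightarrow> 0"
proof -
  have "integrable lborel (\<lambda>x. (p x)\<^sup>2)"
    using fin by (simp add: integrable_iff_bounded L2_sq_def)
  then have lim: "(\<lambda>n. L1_dist (\<lambda>x. (p (x + s n))\<^sup>2) (\<lambda>x. (p x)\<^sup>2)) \<longlonglongrightarrow> 0"
    using s by (rule L1_shift_tendsto_0)
  have ab: "(a - b)\<^sup>2 \<le> \<bar>a\<^sup>2 - b\<^sup>2\<bar>" if "a \<ge> 0" "b \<ge> 0" for a b :: real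
  proof -
    have "(a - b)\<^sup>2 = \<bar>a - b\<bar> * \<bar>a - b\<bar>" by (simp add: power2_eq_square)
    also have "\<dots> \<le> \<bar>a - b\<bar> * \<bar>a + b\<bar>" using that by (intro mult_left_mono) auto
    also have "\<dots> = \<bar>a\<^sup>2 - b\<^sup>2\<bar>" by (simp add: abs_mult[symmetric] power2_eq_square algebra_simps)
    finally show ?thesis .
  qed
  have le: "L2_sq (\<lambda>x. p (x + s n) - p x) \<le> L1_dist (\<lambda>x. (p (x + s n))\<^sup>2) (\<lambda>x. (p x)\<^sup>2)" for n
    unfolding L2_sq_def L1_dist_def by (intro nn_integral_mono ennreal_leI ab nn)
  show ?thesis
    by (rule tendsto_sandwich[OF _ _ tendsto_const lim]) (auto simp: le)
qed

text \<open>The comparison with the difference of squares fails for values of opposite sign, so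
  positive and negative parts are treated separately.\<close>

theorem L2_shift_tendsto_0:
  assumes [measurable]: "v \<in> borel_measurable borel" and fin: "L2_sq v < top" and s: "s \<longlonglongrightarrow> 0"
  shows "(\<lambda>n. L2_sq (\<lambda>x. v (x + s n) - v x)) \<longlonglongrightarrow> 0"
proof -
  let ?p = "\<lambda>x. max 0 (v x)" and ?m = "\<lambda>x. max 0 (- v x)"
  have fin': "L2_sq ?p < top" "L2_sq ?m < top"
    by (rule le_less_trans[OF _ fin], unfold L2_sq_def, intro nn_integral_mono ennreal_leI,
        simp add: max_def)+
  have le: "L2_sq (\<lambda>x. v (x + s n) - v x)
      \<le> 2 * L2_sq (\<lambda>x. ?p (x + s n) - ?p x) + 2 * L2_sq (\<lambda>x. ?m (x + s n) - ?m x)" for n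
  proof -
    have "v (x + s n) - v x = (?p (x + s n) - ?p x) - (?m (x + s n) - ?m x)" for x
      by (simp add: max_def)
    then show ?thesis
      by (simp only:) (rule L2_sq_diff_le; measurable)
  qed
  have "(\<lambda>n. 2 * L2_sq (\<lambda>x. ?p (x + s n) - ?p x) + 2 * L2_sq (\<lambda>x. ?m (x + s n) - ?m x)) \<longlonglongrightarrow> 2 * 0 + 2 * 0"
    by (intro tendsto_add ennreal_tendsto_cmult L2_shift_tendsto_0_nonneg fin' s) auto
  then have lim: "(\<lambda>n. 2 * L2_sq (\<lambda>x. ?p (x + s n) - ?p x) + 2 * L2_sq (\<lambda>x. ?m (x + s n) - ?m x)) \<longlonglongrightarrow> 0"
    by simp
  show ?thesis
    by (rule tendsto_sandwich[OF _ _ tendsto_const lim]) (auto simp: le)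
qed

subsection \<open>Smooth bump functions and mollification\<close>

text \<open>Finite-order form of the smoothness condition in \<open>test_functions\<close>.
  Derivatives are peeled off at the function itself, so sum, product and chain rules follow by
  induction on the order with the function left arbitrary.\<close>

fun diff_upto :: "nat \<Rightarrow> (real \<Rightarrow> real) \<Rightarrow> bool" where
  "diff_upto 0 f \<longleftrightarrow> f differentiable_on UNIV"
| "diff_upto (Suc n) f \<longleftrightarrow> f differentiable_on UNIV \<and> diff_upto n (deriv f)"

lemma diff_upto_iff: "diff_upto n f \<longleftrightarrow> (\<forall>k\<le>n. (deriv ^^ k) f differentiable_on UNIV)"
proof (induction n arbitrary: f)
  case (Suc n)
  have "(\<forall>k\<le>Suc n. (deriv ^^ k) f differentiable_on UNIV) \<longleftrightarrow>
     (deriv ^^ 0) f differentiable_on UNIV \<and> (\<forall>k\<le>n. (deriv ^^ Suc k) f differentiable_on UNIV)"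
    by (metis Suc_le_mono not0_implies_Suc zero_le)
  then show ?case
    by (simp add: Suc funpow_Suc_right del: funpow.simps)
qed simp

lemma diff_upto_0_if:
  assumes "\<And>x. (f has_field_derivative f' x) (at x)"
  shows "diff_upto 0 f"
  using assms real_differentiable_def[of f _ UNIV] by (auto simp: differentiable_on_def)

lemma diff_upto_Suc_iff_derivative:
  assumes "\<And>x. (f has_field_derivative f' x) (at x)"
  shows "diff_upto (Suc n) f \<longleftrightarrow> diff_upto n f'"
proof -
  have "deriv f = f'" using assms by (auto intro: DERIV_imp_deriv)
  then show ?thesis using diff_upto_0_if[OF assms] by simp
qed

lemma diff_upto_has_derivative:
  assumes "diff_upto n f"
  shows "(f has_field_derivative deriv f x) (at x)"
proof -
  have "f differentiable_on UNIV" using assms by (cases n) auto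
  then show ?thesis by (metis DERIV_deriv_iff_real_differentiable UNIV_I differentiable_on_def)
qed

lemma diff_upto_Suc_D: "diff_upto (Suc n) f \<Longrightarrow> diff_upto n f"
  by (induction n arbitrary: f) auto

lemma diff_upto_add: "diff_upto n f \<Longrightarrow> diff_upto n g \<Longrightarrow> diff_upto n (\<lambda>x. f x + g x)"
proof (induction n arbitrary: f g)
  case (Suc n)
  have "((\<lambda>x. f x + g x) has_field_derivative deriv f x + deriv g x) (at x)" for x
    using Suc.prems by (intro DERIV_add diff_upto_has_derivative)
  moreover have "diff_upto n (\<lambda>x. deriv f x + deriv g x)"
    using Suc by auto
  ultimately show ?case by (rule iffD2[OF diff_upto_Suc_iff_derivative])
qed (auto intro: differentiable_on_add)

lemma diff_upto_mult: "diff_upto n f \<Longrightarrow> diff_upto n g \<Longrightarrow> diff_upto n (\<lambda>x. f x * g x)"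
proof (induction n arbitrary: f g)
  case (Suc n)
  have "((\<lambda>x. f x * g x) has_field_derivative deriv f x * g x + deriv g x * f x) (at x)" for x
    using Suc.prems by (intro DERIV_mult diff_upto_has_derivative)
  moreover have "diff_upto n (\<lambda>x. deriv f x * g x + deriv g x * f x)"
    using Suc.prems diff_upto_Suc_D[OF Suc.prems(1)] diff_upto_Suc_D[OF Suc.prems(2)]
    by (intro diff_upto_add Suc.IH) auto
  ultimately show ?case by (rule iffD2[OF diff_upto_Suc_iff_derivative])
qed (auto intro: differentiable_on_mult)

lemma diff_upto_const: "diff_upto n (\<lambda>_. c)"
proof (induction n arbitrary: c)
  case (Suc n)
  then show ?case
    by (subst diff_upto_Suc_iff_derivative[of _ "\<lambda>_. 0"]) auto
qed simp

lemma diff_upto_affine: "diff_upto n f \<Longrightarrow> diff_upto n (\<lambda>x. f (a + b * x))"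
proof (induction n arbitrary: f)
  case 0
  have "((\<lambda>x. f (a + b * x)) has_field_derivative deriv f (a + b * x) * b) (at x)" for x
    by (rule DERIV_chain'[where g = f]) (auto intro!: derivative_eq_intros diff_upto_has_derivative[OF 0])
  then show ?case by (rule diff_upto_0_if)
next
  case (Suc n)
  have "((\<lambda>x. f (a + b * x)) has_field_derivative deriv f (a + b * x) * b) (at x)" for x
    by (rule DERIV_chain'[where g = f]) (auto intro!: derivative_eq_intros diff_upto_has_derivative[OF Suc.prems])
  moreover have "diff_upto n (\<lambda>x. deriv f (a + b * x) * b)"
    using Suc by (intro diff_upto_mult diff_upto_const) auto
  ultimately show ?case by (rule iffD2[OF diff_upto_Suc_iff_derivative])
qed

text \<open>The standard smooth function that is flat at 0, with a polynomial in 1 / x as an extra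
  factor: the enlarged family is closed under differentiation, so one derivative computation gives
  all orders.\<close>

definition flat_exp :: "real poly \<Rightarrow> real \<Rightarrow> real" where
  "flat_exp p x = (if x > 0 then poly p (1 / x) * exp (- (1 / x)) else 0)"

lemma poly_times_exp_tendsto_0: "((\<lambda>x. poly p x * exp (- x)) \<longlongrightarrow> (0::real)) at_top"
proof -
  have "((\<lambda>x. \<Sum>i\<le>degree p. coeff p i * (x ^ i / exp x)) \<longlongrightarrow> (\<Sum>i\<le>degree p. coeff p i * 0)) at_top"
    by (intro tendsto_sum tendsto_mult tendsto_const tendsto_power_div_exp_0)
  also have "(\<lambda>x. \<Sum>i\<le>degree p. coeff p i * (x ^ i / exp x)) = (\<lambda>x. poly p x * exp (- x))"
    by (simp add: poly_altdef sum_distrib_right exp_minus divide_inverse mult.assoc)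
  finally show ?thesis by simp
qed

text \<open>Differentiating \<open>p (1/x) * exp (- 1/x)\<close> replaces the polynomial \<open>p\<close> by \<open>X\<^sup>2 (p - p')\<close>.\<close>

lemma flat_exp_derivative:
  "(flat_exp p has_field_derivative flat_exp ([:0, 0, 1:] * (p - pderiv p)) x) (at x)"
proof (cases "x = 0")
  case False
  show ?thesis
  proof (cases "x > 0")
    case True
    have "((\<lambda>x. poly p (1 / x) * exp (- (1 / x))) has_field_derivative
        flat_exp ([:0, 0, 1:] * (p - pderiv p)) x) (at x)"
      using True by (auto intro!: derivative_eq_intros simp: flat_exp_def field_simps power2_eq_square)
    then show ?thesis
      by (rule has_field_derivative_transform_within_open[of _ _ _ "{0<..}"])
        (use True in \<open>auto simp: flat_exp_def\<close>)
  next
    case n: False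
    have "((\<lambda>_. 0) has_field_derivative 0) (at x)" by simp
    then have "(flat_exp p has_field_derivative 0) (at x)"
      by (rule has_field_derivative_transform_within_open[of _ _ _ "{..<0}"])
        (use False n in \<open>auto simp: flat_exp_def\<close>)
    then show ?thesis using n by (simp add: flat_exp_def)
  qed
next
  case True
  have "((\<lambda>h. flat_exp p h / h) \<longlongrightarrow> 0) (at 0)"
  proof (rule filterlim_split_at)
    show "((\<lambda>h. flat_exp p h / h) \<longlongrightarrow> 0) (at_left 0)"
      by (rule tendsto_eventually) (auto simp: flat_exp_def eventually_at_filter)
    \<comment> \<open>Dividing by \<open>h\<close> multiplies the polynomial in 1 / h by its
      variable, so exponential decay still wins.\<close>
    have "((\<lambda>h. poly ([:0, 1:] * p) (inverse h) * exp (- inverse h)) \<longlongrightarrow> (0::real)) (at_right 0)"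
      by (rule filterlim_compose[OF poly_times_exp_tendsto_0 filterlim_inverse_at_top_right])
    moreover have "eventually (\<lambda>h. poly ([:0, 1:] * p) (inverse h) * exp (- inverse h) = flat_exp p h / h) (at_right (0::real))"
      by (auto simp: eventually_at_filter flat_exp_def field_simps)
    ultimately show "((\<lambda>h. flat_exp p h / h) \<longlongrightarrow> 0) (at_right 0)"
      by (rule Lim_transform_eventually)
  qed
  then show ?thesis
    using True by (simp add: DERIV_def flat_exp_def[of _ 0])
qed

lemma diff_upto_flat_exp: "diff_upto n (flat_exp p)"
proof (induction n arbitrary: p)
  case 0
  show ?case using flat_exp_derivative by (rule diff_upto_0_if)
next
  case (Suc n)
  then show ?case using diff_upto_Suc_iff_derivative[OF flat_exp_derivative] by blast
qed

section \<open>Mollifiers of prescribed support\<close>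

lemma test_functions_UNIV_I:
  assumes "\<And>n. diff_upto n f" and "\<And>x. \<bar>x\<bar> > R \<Longrightarrow> f x = 0"
  shows "f \<in> test_functions UNIV"
proof -
  have "{x. f x \<noteq> 0} \<subseteq> cball 0 R"
    using assms(2) by force
  then have "bounded {x. f x \<noteq> 0}"
    by (rule bounded_subset[rotated]) simp
  then show ?thesis
    using assms(1) by (auto simp: test_functions_def diff_upto_iff compact_closure)
qed

lemma test_functions_diff_upto: "f \<in> test_functions U \<Longrightarrow> diff_upto n f"
  by (auto simp: test_functions_def diff_upto_iff)

text \<open>The product of a flat exponential in \<open>\<delta> + t\<close> and one in
  \<open>\<delta> - t\<close> is positive exactly for |t| < \<delta>. Positivity on an interval of
  positive measure makes the integral nonzero, so the product can be normalised.\<close>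

lemma mollifier_exists:
  fixes \<delta> :: real
  assumes \<delta>: "\<delta> > 0"
  obtains r where "r \<in> test_functions UNIV" "\<And>t. r t \<ge> 0" "\<And>t. \<bar>t\<bar> \<ge> \<delta> \<Longrightarrow> r t = 0"
    "integrable lborel r" "(\<integral>t. r t \<partial>lborel) = 1"
proof -
  define b where "b t = flat_exp 1 (\<delta> + 1 * t) * flat_exp 1 (\<delta> + (- 1) * t)" for t
  have smooth: "diff_upto n b" for n
    unfolding b_def by (intro diff_upto_mult diff_upto_affine diff_upto_flat_exp)
  have supp: "b t = 0" if "\<bar>t\<bar> \<ge> \<delta>" for t
    using that by (auto simp: b_def flat_exp_def)
  have nn: "b t \<ge> 0" for t by (simp add: b_def flat_exp_def)
  have pos: "b t > 0" if "\<bar>t\<bar> < \<delta>" for t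
    using that by (simp add: b_def flat_exp_def)
  have T: "b \<in> test_functions UNIV"
    by (rule test_functions_UNIV_I[OF smooth, of \<delta>]) (simp add: supp)
  obtain L M R where m [measurable]: "b \<in> borel_measurable borel" and M: "\<And>x. \<bar>b x\<bar> \<le> M"
    using test_function_cases[OF T] by metis
  have int: "integrable lborel b"
  proof (rule Bochner_Integration.integrable_bound)
    show "integrable lborel (\<lambda>x. indicator {- \<delta>..\<delta>} x * M)"
      by (intro integrable_mult_left) (simp add: emeasure_lborel_Icc_eq)
    show "AE x in lborel. norm (b x) \<le> norm (indicator {- \<delta>..\<delta>} x * M)"
    proof (rule AE_I2)
      fix x show "norm (b x) \<le> norm (indicator {- \<delta>..\<delta>} x * M)"
      proof (cases "\<bar>x\<bar> \<le> \<delta>")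
        case True
        then have "x \<in> {- \<delta>..\<delta>}" by (auto simp: abs_le_iff)
        moreover have "\<bar>b x\<bar> \<le> \<bar>M\<bar>" using M[of x] by linarith
        ultimately show ?thesis by simp
      qed (simp add: supp)
    qed
  qed simp
  have "(\<integral>t. b t \<partial>lborel) \<noteq> 0"
  proof
    assume "(\<integral>t. b t \<partial>lborel) = 0"
    then have "AE t in lborel. b t = 0"
      using integral_nonneg_eq_0_iff_AE[OF int] nn by simp
    then have "AE t in lborel. t \<notin> {- \<delta><..<\<delta>}"
    proof eventually_elim
      fix t assume "b t = 0"
      then show "t \<notin> {- \<delta><..<\<delta>}" using pos[of t] by (auto simp: abs_less_iff)
    qed
    then have "{- \<delta><..<\<delta>} \<in> null_sets lborel"
      by (subst AE_iff_null_sets) auto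
    then show False using \<delta> by (simp add: null_sets_def)
  qed
  moreover have "(\<integral>t. b t \<partial>lborel) \<ge> 0" using nn by simp
  moreover define c where "c = (\<integral>t. b t \<partial>lborel)"
  ultimately have c: "c > 0" by simp
  show thesis
  proof (rule that[of "\<lambda>t. (1 / c) * b t"])
    show "(\<lambda>t. (1 / c) * b t) \<in> test_functions UNIV"
      by (rule test_functions_UNIV_I[OF diff_upto_mult[OF diff_upto_const smooth], of \<delta>]) (simp add: supp)
    show "(1 / c) * b t \<ge> 0" for t using c nn[of t] by simp
    show "(1 / c) * b t = 0" if "\<bar>t\<bar> \<ge> \<delta>" for t using supp[OF that] by simp
    show "integrable lborel (\<lambda>t. (1 / c) * b t)" using int by (rule integrable_mult_right)
    have "(\<integral>t. (1 / c) * b t \<partial>lborel) = (1 / c) * (\<integral>t. b t \<partial>lborel)"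
      by (rule integral_mult_right_zero)
    then show "(\<integral>t. (1 / c) * b t \<partial>lborel) = 1" using c by (simp add: c_def)
  qed
qed

text \<open>Convolution, written as a weighted average of translates of \<open>v\<close>, the form
  suited to error estimates. For differentiation \<open>mollify_eq\<close> moves the variable
  \<open>y\<close> into the smooth factor.\<close>

definition mollify :: "(real \<Rightarrow> real) \<Rightarrow> (real \<Rightarrow> real) \<Rightarrow> real \<Rightarrow> real" where
  "mollify r v y = (\<integral>t. r t * v (y - t) \<partial>lborel)"

lemma mollify_measurable [measurable]:
  assumes [measurable]: "r \<in> borel_measurable borel" "v \<in> borel_measurable borel"
  shows "mollify r v \<in> borel_measurable borel"
  unfolding mollify_def[abs_def] by measurable

lemma integrable_reflect:
  fixes f :: "real \<Rightarrow> real"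
  assumes "integrable lborel f"
  shows "integrable lborel (\<lambda>t. f (y - t))"
  using lborel_integrable_real_affine[OF assms, of "-1" y] by simp

lemma integrable_bounded_mult:
  fixes f :: "real \<Rightarrow> real"
  assumes [measurable]: "r \<in> borel_measurable borel" and M: "\<And>x. \<bar>r x\<bar> \<le> M" and f: "integrable lborel f"
  shows "integrable lborel (\<lambda>t. r t * f t)"
proof (rule Bochner_Integration.integrable_bound)
  show "integrable lborel (\<lambda>t. M * f t)" using f by simp
  show "AE t in lborel. norm (r t * f t) \<le> norm (M * f t)"
  proof (rule AE_I2)
    fix t
    have "\<bar>r t\<bar> \<le> \<bar>M\<bar>" using M[of t] by linarith
    then show "norm (r t * f t) \<le> norm (M * f t)"
      by (simp add: abs_mult mult_right_mono)
  qed
qed (use f in \<open>auto dest: borel_measurable_integrable\<close>)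

lemma mollify_eq: "mollify r v y = (\<integral>x. r (y - x) * v x \<partial>lborel)"
  unfolding mollify_def
  using lborel_integral_real_affine[of "-1" "\<lambda>x. r (y - x) * v x" y] by simp

text \<open>The derivative falls on \<open>r\<close>. Difference quotients of \<open>r\<close> are
  bounded by its Lipschitz constant, so a multiple of |v| dominates the integrands.\<close>

lemma mollify_derivative:
  assumes r: "r \<in> test_functions UNIV" and v: "integrable lborel v"
  shows "(mollify r v has_field_derivative mollify (deriv r) v y) (at y)"
proof -
  obtain L M R where [measurable]: "r \<in> borel_measurable borel"
    and L: "\<And>x y. \<bar>r x - r y\<bar> \<le> L * \<bar>x - y\<bar>" and M: "\<And>x. \<bar>r x\<bar> \<le> M"
    using test_function_cases[OF r] by metis
  have der: "(r has_field_derivative deriv r x) (at x)" for x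
    using test_functions_diff_upto[OF r, of 0] by (rule diff_upto_has_derivative)
  have "diff_upto 0 (deriv r)"
    using test_functions_diff_upto[OF r, of 1] by simp
  then have "continuous_on UNIV (deriv r)"
    by (simp add: differentiable_imp_continuous_on)
  then have [measurable]: "deriv r \<in> borel_measurable borel"
    by (rule borel_measurable_continuous_onI)
  have [measurable]: "v \<in> borel_measurable borel" using v by (auto dest: borel_measurable_integrable)
  show ?thesis
    unfolding DERIV_def tendsto_at_iff_sequentially comp_def
  proof (intro allI impI)
    \<comment> \<open>The limit is tested along sequences because dominated convergence is applied
      to sequences.\<close>
    fix X :: "nat \<Rightarrow> real"
    assume X: "\<forall>i. X i \<in> UNIV - {0}" "X \<longlonglongrightarrow> 0"
    let ?q = "\<lambda>i x. (r (y + X i - x) - r (y - x)) / X i * v x"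
    have "(\<lambda>i. \<integral>x. ?q i x \<partial>lborel) \<longlonglongrightarrow> (\<integral>x. deriv r (y - x) * v x \<partial>lborel)"
    proof (rule integral_dominated_convergence[where w = "\<lambda>x. L * \<bar>v x\<bar>"])
      show "integrable lborel (\<lambda>x. L * \<bar>v x\<bar>)" using v by simp
      show "AE x in lborel. (\<lambda>i. ?q i x) \<longlonglongrightarrow> deriv r (y - x) * v x"
      proof (rule AE_I2)
        fix x
        have "(\<lambda>i. (r (y - x + X i) - r (y - x)) / X i) \<longlonglongrightarrow> deriv r (y - x)"
          using der[of "y - x"] X unfolding DERIV_def tendsto_at_iff_sequentially comp_def by blast
        then show "(\<lambda>i. ?q i x) \<longlonglongrightarrow> deriv r (y - x) * v x"
          by (intro tendsto_mult tendsto_const) (simp add: algebra_simps)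
      qed
      show "AE x in lborel. norm (?q i x) \<le> L * \<bar>v x\<bar>" for i
      proof (rule AE_I2)
        fix x
        have "\<bar>r (y + X i - x) - r (y - x)\<bar> \<le> L * \<bar>X i\<bar>"
          using L[of "y + X i - x" "y - x"] by simp
        then have "\<bar>(r (y + X i - x) - r (y - x)) / X i\<bar> \<le> L"
          using X(1) by (simp add: abs_divide divide_le_eq)
        then show "norm (?q i x) \<le> L * \<bar>v x\<bar>"
          unfolding real_norm_def abs_mult[of _ "v x"] by (rule mult_right_mono) simp
      qed
    qed measurable
    moreover have "(mollify r v (y + X i) - mollify r v y) / X i = (\<integral>x. ?q i x \<partial>lborel)" for i
    proof -
      have int: "integrable lborel (\<lambda>x. r (z - x) * v x)" for z
        by (rule integrable_bounded_mult[OF _ M v]) measurable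
      have "mollify r v (y + X i) - mollify r v y = (\<integral>x. r (y + X i - x) * v x - r (y - x) * v x \<partial>lborel)"
        unfolding mollify_eq by (rule Bochner_Integration.integral_diff[symmetric]) (rule int)+
      also have "\<dots> / X i = (\<integral>x. (r (y + X i - x) * v x - r (y - x) * v x) / X i \<partial>lborel)"
        by simp
      also have "\<dots> = (\<integral>x. ?q i x \<partial>lborel)"
        by (intro Bochner_Integration.integral_cong) (simp_all add: left_diff_distrib)
      finally show ?thesis .
    qed
    ultimately show "(\<lambda>i. (mollify r v (y + X i) - mollify r v y) / X i) \<longlonglongrightarrow> mollify (deriv r) v y"
      by (simp only: mollify_eq[of "deriv r"])
  qed
qed

lemma deriv_test_function:
  assumes "r \<in> test_functions UNIV"
  shows "deriv r \<in> test_functions UNIV"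
proof -
  obtain R where R: "\<And>x. \<bar>x\<bar> > R \<Longrightarrow> r x = 0"
    using test_function_cases[OF assms] by metis
  show ?thesis
  proof (rule test_functions_UNIV_I[of _ R])
    show "diff_upto n (deriv r)" for n
      using test_functions_diff_upto[OF assms, of "Suc n"] by simp
    show "deriv r x = 0" if "\<bar>x\<bar> > R" for x
    proof -
      have op: "open {x::real. \<bar>x\<bar> > R}" by (intro open_Collect_less continuous_intros)
      have "((\<lambda>_. 0) has_field_derivative deriv r x) (at x)"
        by (rule has_field_derivative_transform_within_open
            [OF diff_upto_has_derivative[OF test_functions_diff_upto[OF assms, of 0]] op])
          (use that R in simp_all)
      then show ?thesis by (auto dest: DERIV_unique[OF _ DERIV_const])
    qed
  qed
qed

lemma diff_upto_mollify:
  assumes "r \<in> test_functions UNIV" and v: "integrable lborel v"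
  shows "diff_upto n (mollify r v)"
  using assms(1)
proof (induction n arbitrary: r)
  case 0
  show ?case using mollify_derivative[OF 0 v] by (rule diff_upto_0_if)
next
  case (Suc n)
  then show ?case
    using diff_upto_Suc_iff_derivative[OF mollify_derivative[OF Suc.prems v]] deriv_test_function by blast
qed

subsection \<open>Approximation by test functions\<close>

text \<open>Jensen's inequality for the probability density \<open>r\<close>, obtained from the
  nonnegativity of the variance. An infinite second moment leaves nothing to prove.\<close>

lemma square_integral_weighted_le:
  fixes r f :: "real \<Rightarrow> real"
  assumes nn: "\<And>t. r t \<ge> 0" and r: "integrable lborel r" "(\<integral>t. r t \<partial>lborel) = 1"
    and f [measurable]: "f \<in> borel_measurable borel" and rf: "integrable lborel (\<lambda>t. r t * f t)"
  shows "ennreal ((\<integral>t. r t * f t \<partial>lborel)\<^sup>2) \<le> (\<integral>\<^sup>+t. ennreal (r t) * ennreal ((f t)\<^sup>2) \<partial>lborel)"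
proof (cases "(\<integral>\<^sup>+t. ennreal (r t * (f t)\<^sup>2) \<partial>lborel) < top")
  case True
  have [measurable]: "r \<in> borel_measurable borel" using r(1) by (auto dest: borel_measurable_integrable)
  have rff: "integrable lborel (\<lambda>t. r t * (f t)\<^sup>2)"
    using True nn by (simp add: integrable_iff_bounded)
  define m where "m = (\<integral>t. r t * f t \<partial>lborel)"
  have "0 \<le> (\<integral>t. r t * (f t - m)\<^sup>2 \<partial>lborel)"
    using nn by simp
  also have "\<dots> = (\<integral>t. r t * (f t)\<^sup>2 - 2 * m * (r t * f t) + m\<^sup>2 * r t \<partial>lborel)"
    by (intro Bochner_Integration.integral_cong) (simp_all add: power2_eq_square algebra_simps)
  also have "\<dots> = (\<integral>t. r t * (f t)\<^sup>2 \<partial>lborel) - 2 * m * m + m\<^sup>2"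
    using rff rf r by (simp add: m_def)
  finally have "m\<^sup>2 \<le> (\<integral>t. r t * (f t)\<^sup>2 \<partial>lborel)"
    by (simp add: power2_eq_square)
  then have "ennreal (m\<^sup>2) \<le> ennreal (\<integral>t. r t * (f t)\<^sup>2 \<partial>lborel)"
    by (rule ennreal_leI)
  also have "\<dots> = (\<integral>\<^sup>+t. ennreal (r t * (f t)\<^sup>2) \<partial>lborel)"
    using nn by (intro nn_integral_eq_integral[symmetric] rff) simp
  finally show ?thesis using nn by (simp add: m_def ennreal_mult')
next
  case False
  then show ?thesis using nn by (simp add: ennreal_mult' less_top[symmetric])
qed

section \<open>The error of mollification in L2 and in energy\<close>

definition mollifier :: "real \<Rightarrow> (real \<Rightarrow> real) \<Rightarrow> bool" where
  "mollifier \<delta> r \<longleftrightarrow> r \<in> test_functions UNIV \<and> (\<forall>t. r t \<ge> 0) \<and> (\<forall>t. \<bar>t\<bar> \<ge> \<delta> \<longrightarrow> r t = 0) \<and>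
    integrable lborel r \<and> (\<integral>t. r t \<partial>lborel) = 1"

lemma mollifier_bounded_measurable:
  assumes "mollifier \<delta> r"
  obtains M where "r \<in> borel_measurable borel" "\<And>x. \<bar>r x\<bar> \<le> M"
  using assms test_function_cases[of r UNIV] unfolding mollifier_def by metis

lemma mollify_diff_eq:
  assumes r: "mollifier \<delta> r" and g: "integrable lborel g"
  shows "integrable lborel (\<lambda>t. r t * (g (y - t) - g y))"
    and "mollify r g y - g y = (\<integral>t. r t * (g (y - t) - g y) \<partial>lborel)"
proof -
  obtain M where M: "r \<in> borel_measurable borel" "\<And>x. \<bar>r x\<bar> \<le> M"
    using mollifier_bounded_measurable[OF r] by metis
  have 1: "integrable lborel (\<lambda>t. r t * g (y - t))"
    by (rule integrable_bounded_mult[OF M integrable_reflect[OF g]])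
  have 2: "integrable lborel (\<lambda>t. r t * g y)" and "(\<integral>t. r t * g y \<partial>lborel) = g y"
    using r by (auto simp: mollifier_def)
  then show "integrable lborel (\<lambda>t. r t * (g (y - t) - g y))"
    "mollify r g y - g y = (\<integral>t. r t * (g (y - t) - g y) \<partial>lborel)"
    using Bochner_Integration.integrable_diff[OF 1 2] Bochner_Integration.integral_diff[OF 1 2]
    by (simp_all add: right_diff_distrib mollify_def)
qed

text \<open>By Jensen and Tonelli the squared error is at most an average, with density
  \<open>r\<close>, of squared L2 increments, and only shifts below \<open>\<delta>\<close> carry
  weight. A small \<open>B\<close> gives convergence; the crude \<open>B = 4 * L2_sq g\<close> gives
  a majorant uniform in the mollifier.\<close>

lemma L2_sq_mollify_diff_le:
  assumes r: "mollifier \<delta> r" and g: "integrable lborel g"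
    and B: "\<And>t. \<bar>t\<bar> < \<delta> \<Longrightarrow> L2_sq (\<lambda>y. g (y + t) - g y) \<le> B"
  shows "L2_sq (\<lambda>y. mollify r g y - g y) \<le> B"
proof -
  have nn: "\<And>t. r t \<ge> 0" and supp: "\<And>t. \<bar>t\<bar> \<ge> \<delta> \<Longrightarrow> r t = 0"
    and int: "integrable lborel r" "(\<integral>t. r t \<partial>lborel) = 1"
    using r by (auto simp: mollifier_def)
  have [measurable]: "r \<in> borel_measurable borel" "g \<in> borel_measurable borel"
    using int(1) g by (auto dest: borel_measurable_integrable)
  have "L2_sq (\<lambda>y. mollify r g y - g y)
      \<le> (\<integral>\<^sup>+y. \<integral>\<^sup>+t. ennreal (r t) * ennreal ((g (y - t) - g y)\<^sup>2) \<partial>lborel \<partial>lborel)"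
    unfolding L2_sq_def mollify_diff_eq(2)[OF r g]
    by (intro nn_integral_mono square_integral_weighted_le nn int mollify_diff_eq(1)[OF r g]) measurable
  also have "\<dots> = (\<integral>\<^sup>+t. \<integral>\<^sup>+y. ennreal (r t) * ennreal ((g (y - t) - g y)\<^sup>2) \<partial>lborel \<partial>lborel)"
    by (rule lborel_pair.Fubini') measurable
  also have "\<dots> = (\<integral>\<^sup>+t. ennreal (r t) * L2_sq (\<lambda>y. g (y + - t) - g y) \<partial>lborel)"
    unfolding L2_sq_def by (intro nn_integral_cong) (simp add: nn_integral_cmult)
  also have "\<dots> \<le> (\<integral>\<^sup>+t. ennreal (r t) * B \<partial>lborel)"
  proof (rule nn_integral_mono)
    fix t
    show "ennreal (r t) * L2_sq (\<lambda>y. g (y + - t) - g y) \<le> ennreal (r t) * B"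
    proof (cases "\<bar>t\<bar> < \<delta>")
      case True
      then show ?thesis by (intro mult_left_mono B) auto
    qed (simp add: supp)
  qed
  also have "\<dots> = (\<integral>\<^sup>+t. ennreal (r t) \<partial>lborel) * B"
    by (rule nn_integral_multc) measurable
  also have "(\<integral>\<^sup>+t. ennreal (r t) \<partial>lborel) = 1"
    using nn_integral_eq_integral[OF int(1)] nn int(2) by simp
  finally show ?thesis by simp
qed

lemma L2_sq_increment_le:
  assumes [measurable]: "g \<in> borel_measurable borel"
  shows "L2_sq (\<lambda>y. g (y + t) - g y) \<le> 4 * L2_sq g"
proof -
  have "L2_sq (\<lambda>y. g (y + t) - g y) \<le> 2 * L2_sq (\<lambda>y. g (y + t)) + 2 * L2_sq g"
    by (rule L2_sq_diff_le) measurable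
  also have "\<dots> = (2 + 2) * L2_sq g"
    by (simp only: L2_sq_shift[OF assms] distrib_right)
  finally show ?thesis by simp
qed

lemma L2_sq_mollify_diff_tendsto_0:
  assumes r: "\<And>n. mollifier (\<delta> n) (r n)" and \<delta>: "\<delta> \<longlonglongrightarrow> 0"
    and g: "integrable lborel g" and fin: "L2_sq g < top"
  shows "(\<lambda>n. L2_sq (\<lambda>y. mollify (r n) g y - g y)) \<longlonglongrightarrow> 0"
  unfolding ennreal_tendsto_0_iff
proof (intro allI impI)
  fix e :: real assume "e > 0"
  have gm: "g \<in> borel_measurable borel" using g by (auto dest: borel_measurable_integrable)
  \<comment> \<open>Continuity along sequences is turned into a threshold \<open>d\<close> valid for
    all small shifts at once, as the averaging bound requires.\<close>
  have "((\<lambda>t. L2_sq (\<lambda>y. g (y + t) - g y)) \<longlongrightarrow> 0) (at 0)"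
    unfolding tendsto_at_iff_sequentially comp_def using L2_shift_tendsto_0[OF gm fin] by blast
  then have "eventually (\<lambda>t. L2_sq (\<lambda>y. g (y + t) - g y) \<le> ennreal e) (at 0)"
    using \<open>e > 0\<close> by (simp add: ennreal_tendsto_0_iff)
  then obtain d where d: "d > 0" "\<And>t. t \<noteq> 0 \<Longrightarrow> \<bar>t\<bar> < d \<Longrightarrow> L2_sq (\<lambda>y. g (y + t) - g y) \<le> ennreal e"
    by (auto simp: eventually_at dist_real_def)
  have d0: "L2_sq (\<lambda>y. g (y + t) - g y) \<le> ennreal e" if "\<bar>t\<bar> < d" for t
  proof (cases "t = 0")
    case True
    then show ?thesis by (simp add: L2_sq_def)
  qed (use d that in auto)
  have "eventually (\<lambda>n. \<delta> n < d) sequentially"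
    using \<delta> d(1) by (rule order_tendstoD(2))
  then show "eventually (\<lambda>n. L2_sq (\<lambda>y. mollify (r n) g y - g y) \<le> ennreal e) sequentially"
    by eventually_elim (rule L2_sq_mollify_diff_le[OF r g d0], simp)
qed

text \<open>Mollification commutes with translations, so the energy of the error is an average over \<open>h\<close>
  of the \<open>L\<^sup>2\<close> errors for the increments \<open>y \<mapsto> v (y + h) - v y\<close>.\<close>

lemma energy_mollify_diff_tendsto_0:
  assumes \<beta>: "\<beta> \<in> {0<..<2}" and r: "\<And>n. mollifier (\<delta> n) (r n)" and \<delta>: "\<delta> \<longlonglongrightarrow> 0"
    and v: "integrable lborel v" and vH: "v \<in> sobolev_H \<beta>"
  shows "(\<lambda>n. energy \<beta> (\<lambda>y. mollify (r n) v y - v y)) \<longlonglongrightarrow> 0"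
proof -
  have [measurable]: "v \<in> borel_measurable borel" and fin: "L2_sq v < top" "energy \<beta> v < top"
    using vH by (auto simp: sobolev_H_def)
  have rm [measurable]: "r n \<in> borel_measurable borel" for n
    using mollifier_bounded_measurable[OF r[of n]] by metis
  let ?g = "\<lambda>h y. v (y + h) - v y"
  let ?w = "\<lambda>n y. mollify (r n) v y - v y"
  have vh: "integrable lborel (\<lambda>y. v (y + h))" for h
    using lborel_integrable_real_affine[OF v, of 1 h] by (simp add: add.commute)
  have g: "integrable lborel (?g h)" for h
    using vh v by simp
  have gfin: "L2_sq (?g h) < top" for h
    by (rule le_less_trans[OF L2_sq_increment_le]) (use fin in \<open>auto simp: ennreal_mult_less_top\<close>)
  have w: "?w n (y + h) - ?w n y = mollify (r n) (?g h) y - ?g h y" for n h y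
  proof -
    obtain M where M: "r n \<in> borel_measurable borel" "\<And>x. \<bar>r n x\<bar> \<le> M"
      using mollifier_bounded_measurable[OF r[of n]] by metis
    have "mollify (r n) (?g h) y = (\<integral>t. r n t * v (y - t + h) - r n t * v (y - t) \<partial>lborel)"
      by (simp add: mollify_def right_diff_distrib)
    also have "\<dots> = (\<integral>t. r n t * v (y - t + h) \<partial>lborel) - (\<integral>t. r n t * v (y - t) \<partial>lborel)"
      by (intro Bochner_Integration.integral_diff integrable_bounded_mult[OF M] integrable_reflect[OF vh] integrable_reflect[OF v])
    also have "\<dots> = mollify (r n) v (y + h) - mollify (r n) v y"
      by (simp add: mollify_def algebra_simps)
    finally show ?thesis by simp
  qed
  let ?F = "\<lambda>n h. ennreal (q_kernel \<beta> h) * L2_sq (\<lambda>y. ?w n (y + h) - ?w n y)"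
  have "(\<lambda>n. \<integral>\<^sup>+h. ?F n h \<partial>lborel) \<longlonglongrightarrow> (\<integral>\<^sup>+h. 0 \<partial>(lborel :: real measure))"
  proof (rule nn_integral_dominated_convergence[where w = "\<lambda>h. 4 * (ennreal (q_kernel \<beta> h) * L2_sq (?g h))"])
    show "AE h in lborel. ?F n h \<le> 4 * (ennreal (q_kernel \<beta> h) * L2_sq (?g h))" for n
    proof (rule AE_I2)
      fix h
      \<comment> \<open>This bound is independent of \<open>n\<close>. Integrated against the kernel
        it yields 8 times the energy of \<open>v\<close>, hence a finite majorant.\<close>
      have "L2_sq (\<lambda>y. mollify (r n) (?g h) y - ?g h y) \<le> 4 * L2_sq (?g h)"
        by (rule L2_sq_mollify_diff_le[OF r g L2_sq_increment_le]) measurable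
      then have "ennreal (q_kernel \<beta> h) * L2_sq (\<lambda>y. mollify (r n) (?g h) y - ?g h y)
          \<le> ennreal (q_kernel \<beta> h) * (4 * L2_sq (?g h))"
        by (rule mult_left_mono) simp
      then show "?F n h \<le> 4 * (ennreal (q_kernel \<beta> h) * L2_sq (?g h))"
        by (simp only: w mult.left_commute)
    qed
    show "AE h in lborel. (\<lambda>n. ?F n h) \<longlonglongrightarrow> 0"
    proof (rule AE_I2)
      fix h
      have "(\<lambda>n. L2_sq (\<lambda>y. mollify (r n) (?g h) y - ?g h y)) \<longlonglongrightarrow> 0"
        by (rule L2_sq_mollify_diff_tendsto_0[OF r \<delta> g gfin])
      then have "(\<lambda>n. ennreal (q_kernel \<beta> h) * L2_sq (\<lambda>y. mollify (r n) (?g h) y - ?g h y)) \<longlonglongrightarrow> ennreal (q_kernel \<beta> h) * 0"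
        by (intro ennreal_tendsto_cmult) simp
      then show "(\<lambda>n. ?F n h) \<longlonglongrightarrow> 0" by (simp only: w mult_zero_right)
    qed
    have "(\<integral>\<^sup>+h. 4 * (ennreal (q_kernel \<beta> h) * L2_sq (?g h)) \<partial>lborel)
        = 4 * (\<integral>\<^sup>+h. ennreal (q_kernel \<beta> h) * L2_sq (?g h) \<partial>lborel)"
      by (rule nn_integral_cmult) measurable
    also have "\<dots> < top"
    proof -
      have "(\<integral>\<^sup>+h. ennreal (q_kernel \<beta> h) * L2_sq (?g h) \<partial>lborel) < top"
        using fin(2) by (simp only: energy_eq_increments[OF \<open>v \<in> borel_measurable borel\<close> \<beta>] ennreal_half_less_top_iff)
      then show ?thesis by (simp add: ennreal_mult_less_top)
    qed
    finally show "(\<integral>\<^sup>+h. 4 * (ennreal (q_kernel \<beta> h) * L2_sq (?g h)) \<partial>lborel) < \<infinity>" by simp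
  qed measurable
  then have "(\<lambda>n. (1 / 2) * (\<integral>\<^sup>+h. ?F n h \<partial>lborel)) \<longlonglongrightarrow> (1 / 2) * (\<integral>\<^sup>+h. 0 \<partial>(lborel :: real measure))"
    by (intro ennreal_tendsto_cmult) (use ennreal_half_less_top_iff[of 1] in simp_all)
  moreover have "energy \<beta> (?w n) = (1 / 2) * (\<integral>\<^sup>+h. ?F n h \<partial>lborel)" for n
    by (rule energy_eq_increments[OF _ \<beta>]) measurable
  ultimately show ?thesis by simp
qed

text \<open>On the bounded support |v| \<le> 1 + v^2 is integrable. This brings cut-off functions
  within reach of the mollification lemmas, which ask for integrability.\<close>

lemma integrable_if_L2_bounded_support:
  assumes [measurable]: "v \<in> borel_measurable borel" and fin: "L2_sq v < top"
    and supp: "\<And>y. \<bar>y\<bar> > b \<Longrightarrow> v y = 0"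
  shows "integrable lborel v"
proof (rule Bochner_Integration.integrable_bound)
  show "integrable lborel (\<lambda>y. indicator {- b..b} y + (v y)\<^sup>2)"
  proof (rule Bochner_Integration.integrable_add)
    show "integrable lborel (indicator {- b..b} :: real \<Rightarrow> real)" by (simp add: emeasure_lborel_Icc_eq)
    show "integrable lborel (\<lambda>y. (v y)\<^sup>2)" using fin by (simp add: integrable_iff_bounded L2_sq_def)
  qed
  show "AE y in lborel. norm (v y) \<le> norm (indicator {- b..b} y + (v y)\<^sup>2)"
  proof (rule AE_I2)
    fix y
    show "norm (v y) \<le> norm (indicator {- b..b} y + (v y)\<^sup>2)"
    proof (cases "\<bar>y\<bar> > b")
      case False
      then have "y \<in> {- b..b}" by (auto simp: not_less abs_le_iff)
      moreover have "\<bar>v y\<bar> \<le> 1 + (v y)\<^sup>2"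
      proof -
        have "0 \<le> (\<bar>v y\<bar> - 1)\<^sup>2" by simp
        then have "2 * \<bar>v y\<bar> \<le> 1 + (v y)\<^sup>2" by (simp add: power2_diff)
        then show ?thesis by simp
      qed
      ultimately show ?thesis by simp
    qed (simp add: supp)
  qed
qed measurable

text \<open>Mollification moves points of the support by less than \<delta> \<le> a / 2, so the
  range a \<le> |y| \<le> b grows at most to a / 2 \<le> |y| \<le> b + a / 2 and still avoids
  0.\<close>

lemma mollify_in_test_functions:
  assumes r: "mollifier \<delta> r" and v: "integrable lborel v" and \<delta>: "\<delta> \<le> a / 2" "a > 0"
    and supp: "\<And>y. v y \<noteq> 0 \<Longrightarrow> a \<le> \<bar>y\<bar> \<and> \<bar>y\<bar> \<le> b"
  shows "mollify r v \<in> test_functions (- {0})"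
proof -
  define K where "K = {y::real. a / 2 \<le> \<bar>y\<bar>} \<inter> {y. \<bar>y\<bar> \<le> b + a / 2}"
  have "mollify r v y = 0" if "y \<notin> K" for y
  proof -
    have "r t * v (y - t) = 0" for t
    proof (rule ccontr)
      assume "r t * v (y - t) \<noteq> 0"
      then have "r t \<noteq> 0" "a \<le> \<bar>y - t\<bar>" "\<bar>y - t\<bar> \<le> b" using supp[of "y - t"] by auto
      then have "\<bar>t\<bar> < \<delta>" using r by (metis mollifier_def not_less)
      with \<open>a \<le> \<bar>y - t\<bar>\<close> \<open>\<bar>y - t\<bar> \<le> b\<close> \<delta> have "y \<in> K"
        unfolding K_def by auto
      with that show False by simp
    qed
    then show ?thesis unfolding mollify_def by (simp only: Bochner_Integration.integral_zero)
  qed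
  then have sub: "{y. mollify r v y \<noteq> 0} \<subseteq> K" by auto
  have "closed K" unfolding K_def by (intro closed_Int closed_Collect_le continuous_intros)
  then have cl: "closure {y. mollify r v y \<noteq> 0} \<subseteq> K" using sub by (rule closure_minimal[rotated])
  have "K \<subseteq> cball 0 (b + a / 2)" by (auto simp: K_def)
  then have "bounded {y. mollify r v y \<noteq> 0}"
    using sub by (meson bounded_cball bounded_subset)
  then have "compact (closure {y. mollify r v y \<noteq> 0})" by (simp add: compact_closure)
  moreover have "K \<subseteq> - {0}" using \<delta> by (auto simp: K_def)
  moreover have "diff_upto n (mollify r v)" for n
    using r v by (intro diff_upto_mollify) (auto simp: mollifier_def)
  ultimately show ?thesis
    using cl by (auto simp: test_functions_def diff_upto_iff)
qed

lemma test_functions_dense_compact_support: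
  assumes \<beta>: "\<beta> \<in> {0<..<2}" and vH: "v \<in> sobolev_H \<beta>" and a: "a > 0"
    and supp: "\<And>y. v y \<noteq> 0 \<Longrightarrow> a \<le> \<bar>y\<bar> \<and> \<bar>y\<bar> \<le> b" and e: "e > 0"
  obtains \<phi> where "\<phi> \<in> test_functions (- {0})" "L2_sq (\<lambda>y. \<phi> y - v y) \<le> ennreal e"
    "energy \<beta> (\<lambda>y. \<phi> y - v y) \<le> ennreal e"
proof -
  have [measurable]: "v \<in> borel_measurable borel" and fin: "L2_sq v < top"
    using vH by (auto simp: sobolev_H_def)
  have v: "integrable lborel v"
    using supp by (intro integrable_if_L2_bounded_support[of v b] fin) (auto simp: not_le[symmetric])
  \<comment> \<open>Scaled so that \<open>\<delta> n \<le> a / 2\<close> already from n = 0, which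
    keeps every mollified support away from 0.\<close>
  define \<delta> where "\<delta> n = a / 2 * inverse (real (Suc n))" for n
  have \<delta>pos: "\<delta> n > 0" for n using a by (simp add: \<delta>_def)
  have "\<exists>r. mollifier (\<delta> n) r" for n
    using mollifier_exists[OF \<delta>pos] unfolding mollifier_def by metis
  then obtain r where r: "\<And>n. mollifier (\<delta> n) (r n)" by metis
  have \<delta>: "\<delta> \<longlonglongrightarrow> 0"
    unfolding \<delta>_def[abs_def] by (rule tendsto_mult_right_zero[OF LIMSEQ_inverse_real_of_nat])
  have "eventually (\<lambda>n. L2_sq (\<lambda>y. mollify (r n) v y - v y) \<le> ennreal e) sequentially"
    using L2_sq_mollify_diff_tendsto_0[OF r \<delta> v fin] e unfolding ennreal_tendsto_0_iff by blast
  moreover have "eventually (\<lambda>n. energy \<beta> (\<lambda>y. mollify (r n) v y - v y) \<le> ennreal e) sequentially"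
    using energy_mollify_diff_tendsto_0[OF \<beta> r \<delta> v vH] e unfolding ennreal_tendsto_0_iff by blast
  ultimately have "eventually (\<lambda>n. L2_sq (\<lambda>y. mollify (r n) v y - v y) \<le> ennreal e \<and>
      energy \<beta> (\<lambda>y. mollify (r n) v y - v y) \<le> ennreal e) sequentially"
    by (rule eventually_conj)
  then obtain n where n: "L2_sq (\<lambda>y. mollify (r n) v y - v y) \<le> ennreal e"
      "energy \<beta> (\<lambda>y. mollify (r n) v y - v y) \<le> ennreal e"
    by (auto dest: eventually_happens)
  have "\<delta> n \<le> a / 2 * 1"
    unfolding \<delta>_def using a by (intro mult_left_mono) (auto simp: inverse_le_1_iff)
  then have "mollify (r n) v \<in> test_functions (- {0})"
    using a by (intro mollify_in_test_functions[OF r v _ a supp]) auto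
  then show thesis using n by (rule that)
qed

lemma test_functions_dense:
  assumes \<beta>: "\<beta> \<in> {0<..<2}" and u: "u \<in> sobolev_H \<beta>" and fin: "hardy_sq \<beta> u < top" and e: "e > 0"
  obtains \<phi> where "\<phi> \<in> test_functions (- {0})" "L2_sq (\<lambda>y. \<phi> y - u y) \<le> ennreal e"
    "energy \<beta> (\<lambda>y. \<phi> y - u y) \<le> ennreal e"
proof -
  have [measurable]: "u \<in> borel_measurable borel" and uf: "L2_sq u < top" "energy \<beta> u < top"
    using u by (auto simp: sobolev_H_def)
  \<comment> \<open>Two errors, each doubled by the squared triangle inequality, add up to
    \<open>e\<close>.\<close>
  define e' where "e' = e / 4"
  have e': "e' > 0" using e by (simp add: e'_def)
  have "eventually (\<lambda>n. L2_sq (\<lambda>y. u y * log_cutoff n y - u y) \<le> ennreal e' \<and>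
      energy \<beta> (\<lambda>y. u y * log_cutoff n y - u y) \<le> ennreal e') sequentially"
    using log_cutoff_error_tendsto_0[OF \<beta> u fin] e'
    unfolding ennreal_tendsto_0_iff by (intro eventually_conj) blast+
  then obtain n where n: "L2_sq (\<lambda>y. u y * log_cutoff n y - u y) \<le> ennreal e'"
      "energy \<beta> (\<lambda>y. u y * log_cutoff n y - u y) \<le> ennreal e'"
    by (auto dest: eventually_happens)
  define v where "v y = u y * log_cutoff n y" for y
  have vm [measurable]: "v \<in> borel_measurable borel" unfolding v_def[abs_def] by measurable
  \<comment> \<open>Finite energy of the product \<open>v\<close> is read off from
    \<open>v = u - (u - v)\<close>: the error \<open>u - v\<close> has just been made small, so no
    separate estimate of a product is required.\<close>
  have wH: "(\<lambda>y. u y - v y) \<in> sobolev_H \<beta>"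
  proof -
    have "energy \<beta> (\<lambda>y. u y - v y) \<le> ennreal e'"
      using n(2) energy_uminus[of \<beta> "\<lambda>y. u y * log_cutoff n y - u y"] by (simp add: v_def)
    moreover have "L2_sq (\<lambda>y. u y - v y) \<le> ennreal e'"
      using n(1) by (subst L2_sq_diff_commute) (simp add: v_def)
    ultimately show ?thesis
      by (auto simp: sobolev_H_def intro: le_less_trans)
  qed
  have vH: "v \<in> sobolev_H \<beta>"
    using sobolev_H_diff[OF u wH \<beta>] by simp
  have "exp (- 2 * (real n + 1)) \<le> \<bar>y\<bar> \<and> \<bar>y\<bar> \<le> exp (2 * (real n + 1))" if "v y \<noteq> 0" for y
    using that log_cutoff_support[of n y] by (auto simp: v_def)
  then obtain \<phi> where \<phi>: "\<phi> \<in> test_functions (- {0})" "L2_sq (\<lambda>y. \<phi> y - v y) \<le> ennreal e'"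
    "energy \<beta> (\<lambda>y. \<phi> y - v y) \<le> ennreal e'"
    using test_functions_dense_compact_support[OF \<beta> vH _ _ e', of "exp (- 2 * (real n + 1))" "exp (2 * (real n + 1))"]
    by (metis exp_gt_zero)
  have [measurable]: "\<phi> \<in> borel_measurable borel"
    using test_function_cases[OF \<phi>(1)] by metis
  have split: "(\<lambda>y. \<phi> y - u y) = (\<lambda>y. (\<phi> y - v y) + (v y - u y))" by simp
  have sum: "2 * ennreal e' + 2 * ennreal e' = ennreal e"
    using e by (simp add: e'_def flip: ennreal_plus ennreal_mult' ennreal_numeral)
  have "L2_sq (\<lambda>y. \<phi> y - u y) \<le> 2 * L2_sq (\<lambda>y. \<phi> y - v y) + 2 * L2_sq (\<lambda>y. v y - u y)"
    unfolding split by (rule L2_sq_add_le) measurable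
  also have "\<dots> \<le> 2 * ennreal e' + 2 * ennreal e'"
    using n \<phi> by (intro add_mono mult_left_mono) (auto simp: v_def)
  finally have 1: "L2_sq (\<lambda>y. \<phi> y - u y) \<le> ennreal e" by (simp only: sum)
  have "energy \<beta> (\<lambda>y. \<phi> y - u y) \<le> 2 * energy \<beta> (\<lambda>y. \<phi> y - v y) + 2 * energy \<beta> (\<lambda>y. v y - u y)"
    unfolding split by (rule energy_add_le[OF _ _ \<beta>]) measurable
  also have "\<dots> \<le> 2 * ennreal e' + 2 * ennreal e'"
    using n \<phi> by (intro add_mono mult_left_mono) (auto simp: v_def)
  finally have "energy \<beta> (\<lambda>y. \<phi> y - u y) \<le> ennreal e" by (simp only: sum)
  with \<phi>(1) 1 show thesis by (rule that)
qed

lemma sobolev_H0_if_hardy_sq_finite: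
  assumes \<beta>: "\<beta> \<in> {0<..<2}" and u: "u \<in> sobolev_H \<beta>" and fin: "hardy_sq \<beta> u < top"
  shows "u \<in> sobolev_H0 \<beta>"
proof -
  have "\<exists>\<phi>. \<phi> \<in> test_functions (- {0}) \<and> L2_sq (\<lambda>y. \<phi> y - u y) \<le> ennreal (inverse (real (Suc n))) \<and>
    energy \<beta> (\<lambda>y. \<phi> y - u y) \<le> ennreal (inverse (real (Suc n)))" for n
    using test_functions_dense[OF \<beta> u fin, of "inverse (real (Suc n))"]
    by (metis inverse_positive_iff_positive of_nat_0_less_iff zero_less_Suc)
  then obtain \<phi> where \<phi>: "\<And>n. \<phi> n \<in> test_functions (- {0})"
    "\<And>n. L2_sq (\<lambda>y. \<phi> n y - u y) \<le> ennreal (inverse (real (Suc n)))"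
    "\<And>n. energy \<beta> (\<lambda>y. \<phi> n y - u y) \<le> ennreal (inverse (real (Suc n)))"
    by metis
  have le: "sobolev_norm \<beta> (\<lambda>y. \<phi> n y - u y) \<le> sqrt (2 * inverse (real (Suc n)))" for n
  proof -
    have "L2_sq (\<lambda>y. \<phi> n y - u y) + energy \<beta> (\<lambda>y. \<phi> n y - u y)
        \<le> ennreal (inverse (real (Suc n))) + ennreal (inverse (real (Suc n)))"
      by (intro add_mono \<phi>)
    also have "\<dots> = ennreal (2 * inverse (real (Suc n)))"
      by (subst ennreal_plus[symmetric]) auto
    finally show ?thesis
      unfolding sobolev_norm_def by (intro real_sqrt_le_mono enn2real_leI) auto
  qed
  have lim: "(\<lambda>n. sqrt (2 * inverse (real (Suc n)))) \<longlonglongrightarrow> 0"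
    using tendsto_real_sqrt[OF tendsto_mult_right_zero[OF LIMSEQ_inverse_real_of_nat, of 2]] by simp
  have "(\<lambda>n. sobolev_norm \<beta> (\<lambda>y. \<phi> n y - u y)) \<longlonglongrightarrow> 0"
  proof (rule tendsto_sandwich[OF always_eventually always_eventually tendsto_const lim], safe)
    show "0 \<le> sobolev_norm \<beta> (\<lambda>y. \<phi> n y - u y)" for n
      by (simp add: sobolev_norm_def)
  qed (rule le)
  with \<phi>(1) u show ?thesis by (auto simp: sobolev_H0_def)
qed

theorem proposition6p3:
  fixes \<beta> :: real
  assumes "\<beta> \<in> {0<..<2}" and "\<beta> \<noteq> 1"
  shows "sobolev_H0 \<beta> =
    {u \<in> sobolev_H \<beta>. (\<integral>\<^sup>+ y. ennreal ((u y)\<^sup>2 / \<bar>y\<bar> powr \<beta>) \<partial>lborel) < \<infinity>}"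
proof -
  have "sobolev_H0 \<beta> = {u \<in> sobolev_H \<beta>. hardy_sq \<beta> u < top}"
    using hardy_sq_finite_if_sobolev_H0[OF assms] sobolev_H0_if_hardy_sq_finite[OF assms(1)]
    by (auto simp: sobolev_H0_def)
  then show ?thesis by (simp add: hardy_sq_def)
qed

end
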